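(* Let $n>3$ and let $p$ be a permutation pattern. If $p$ is not periodic for $3$, then $p$ is not periodic for $n$.
   Context: An affine permutation of size $n$ is a bijection $w:\mathbb{Z}\to\mathbb{Z}$ with $w(i+n)=w(i)+n$ for all $i$ and $w(1)+\cdots+w(n)=\binom{n+1}{2}$; $\widetilde{S}_n$ is the group of these, generated by $s_0,\dots,s_{n-1}$ where $ws_i$ swaps the values at positions $i+mn$ and $i+1+mn$ for all $m$; $\ell(w)$ is the minimal number of generators in a factorization. $w$ contains $p\in S_k$ if there exist integers $i_1<\cdots<i_k$ with $w(i_1),\dots,w(i_k)$ in the same relative order as $p_1,\dots,p_k$, otherwise avoids $p$. With $F_{p,n}(x)=\sum_{w\in\widetilde{S}_n,\,w\text{ avoids }p}x^{\ell(w)}=\sum_ia_ix^i$, $p$ is periodic for $n$ if there exist $N\ge1$ and $i_0$ with $a_i=a_{i-N}$ for all $i\ge i_0$. *)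

theory Defs
  imports Main
begin

definition affine_perm :: "nat \<Rightarrow> (int \<Rightarrow> int) \<Rightarrow> bool" where
  "affine_perm n w \<longleftrightarrow> bij w \<and> (\<forall>i. w (i + int n) = w i + int n)
     \<and> (\<Sum>i\<in>{1..int n}. w i) = int ((n + 1) choose 2)"

definition gen :: "nat \<Rightarrow> nat \<Rightarrow> int \<Rightarrow> int" where
  "gen n i j = (if j mod int n = int i mod int n then j + 1
               else if j mod int n = (int i + 1) mod int n then j - 1 else j)"

definition word_prod :: "nat \<Rightarrow> nat list \<Rightarrow> int \<Rightarrow> int" where
  "word_prod n ws = foldr (\<lambda>i f. gen n i \<circ> f) ws id"

definition aff_length :: "nat \<Rightarrow> (int \<Rightarrow> int) \<Rightarrow> nat" where
  "aff_length n w = (LEAST k. \<exists>ws. length ws = k \<and> set ws \<subseteq> {0..<n} \<and> w = word_prod n ws)"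

definition is_pattern :: "nat list \<Rightarrow> bool" where
  "is_pattern p \<longleftrightarrow> distinct p \<and> set p = {1..length p}"

definition contains :: "(int \<Rightarrow> int) \<Rightarrow> nat list \<Rightarrow> bool" where
  "contains w p \<longleftrightarrow> (\<exists>idx :: nat \<Rightarrow> int.
      (\<forall>a b. a < b \<and> b < length p \<longrightarrow> idx a < idx b) \<and>
      (\<forall>a b. a < length p \<and> b < length p \<longrightarrow> (w (idx a) < w (idx b) \<longleftrightarrow> p ! a < p ! b)))"

definition avoids :: "(int \<Rightarrow> int) \<Rightarrow> nat list \<Rightarrow> bool" where
  "avoids w p \<longleftrightarrow> \<not> contains w p"

text \<open>Coefficient a_i of F_{p,n}(x); zero for negative i.\<close>
definition coeffF :: "nat list \<Rightarrow> nat \<Rightarrow> int \<Rightarrow> nat" where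
  "coeffF p n i = card {w. affine_perm n w \<and> avoids w p \<and> int (aff_length n w) = i}"

definition periodic_for :: "nat list \<Rightarrow> nat \<Rightarrow> bool" where
  "periodic_for p n \<longleftrightarrow> (\<exists>N::int \<ge> 1. \<exists>i0::int. \<forall>i \<ge> i0. coeffF p n i = coeffF p n (i - N))"

end

theory Submission
  imports Defs
begin

text \<open>
An affine permutation of size 3 is a residue part \<open>s\<close> together with a lattice point \<open>(x, y)\<close>, and its
graph lies on three parallel lines of slope 1. For fixed \<open>s\<close> and a fixed assignment of the entries of
\<open>p\<close> to the three lines, containing \<open>p\<close> is a system of difference constraints, whose solvability is a
finite conjunction of integral affine inequalities in \<open>(x, y)\<close>. So the avoiders are cut out by
finitely many half-planes.

If all avoiders lie on finitely many lines, then their number in each length is eventually periodic,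
because by Shi's formula the length is eventually linear along rays. Hence non-periodicity
for 3 gives an avoider far from all bounding lines, and then a two-dimensional cone of avoiders.
In size \<open>n\<close>, a translation whose graph lies on three parallel lines and which contains \<open>p\<close> can be
rescaled to an affine permutation of size 3 with the same ratio of offsets containing \<open>p\<close>.
The cone therefore gives about \<open>L\<^sup>2\<close> avoiding translations in size \<open>n\<close> of length \<open>O(L)\<close>, so the
coefficients are unbounded, whereas an eventually periodic sequence is bounded.
\<close>

section \<open>Eventually periodic counts along lattice lines\<close>

text \<open>The quantifiers are those of \<open>periodic_for\<close>, so
  \<open>periodic_for p n\<close> unfolds to the same formula as
  \<open>eventually_periodic (coeffF p n)\<close>.\<close>

definition eventually_periodic :: "(int \<Rightarrow> nat) \<Rightarrow> bool" where
  "eventually_periodic f \<longleftrightarrow> (\<exists>N\<ge>1. \<exists>i0. \<forall>i\<ge>i0. f i = f (i - N))"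

lemma eventually_periodic_multiple:
  fixes f :: "int \<Rightarrow> nat"
  assumes "\<forall>i\<ge>i0. f i = f (i - N)" "N \<ge> 1"
  shows "i \<ge> i0 + int k * N \<Longrightarrow> f i = f (i - int k * N)"
proof (induction k)
  case (Suc k)
  have "i \<ge> i0 + int k * N" using Suc.prems assms(2) by (simp add: algebra_simps)
  then have "f i = f (i - int k * N)" by (rule Suc.IH)
  also have "\<dots> = f (i - int k * N - N)"
    using assms Suc.prems by (simp add: algebra_simps)
  finally show ?case by (simp add: algebra_simps)
qed simp

lemma eventually_periodic_add:
  assumes "eventually_periodic f" "eventually_periodic g"
  shows "eventually_periodic (\<lambda>i. f i + g i)"
proof -
  obtain N i0 where N: "N \<ge> 1" "\<forall>i\<ge>i0. f i = f (i - N)"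
    using assms(1) unfolding eventually_periodic_def by blast
  obtain M j0 where M: "M \<ge> 1" "\<forall>i\<ge>j0. g i = g (i - M)"
    using assms(2) unfolding eventually_periodic_def by blast
  \<comment> \<open>The product of the two periods is a common period; the thresholds are raised by
    it so that all intermediate steps down stay in the periodic range of both functions.\<close>
  have "f i + g i = f (i - M * N) + g (i - M * N)" if "i \<ge> max (i0 + M * N) (j0 + M * N)" for i
    using eventually_periodic_multiple[OF N(2,1), of "nat M" i]
      eventually_periodic_multiple[OF M(2,1), of "nat N" i] N(1) M(1) that
    by (simp add: mult.commute)
  moreover have "M * N \<ge> 1" using N(1) M(1) mult_mono[of 1 M 1 N] by simp
  ultimately show ?thesis unfolding eventually_periodic_def by blast
qed

lemma eventually_periodic_zero: "eventually_periodic (\<lambda>_. 0)"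
  unfolding eventually_periodic_def by (intro exI[of _ 1]) simp

lemma eventually_periodic_sum:
  assumes "finite I" "\<And>s. s \<in> I \<Longrightarrow> eventually_periodic (f s)"
  shows "eventually_periodic (\<lambda>i. \<Sum>s\<in>I. f s i)"
  using assms by (induction I) (auto simp: eventually_periodic_add eventually_periodic_zero)

lemma eventually_periodic_bounded:
  assumes "eventually_periodic f"
  shows "\<exists>B. \<forall>i\<ge>0. f i \<le> B"
proof -
  obtain N i0 where N: "N \<ge> 1" "\<forall>i\<ge>i0. f i = f (i - N)"
    using assms unfolding eventually_periodic_def by blast
  \<comment> \<open>One step down by \<open>N\<close> from an argument at least \<open>i0\<close>
    stays at or above \<open>m\<close>. Strong induction from \<open>m\<close> therefore carries
    every value back to the finite interval over which \<open>B\<close> is the maximum.\<close>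
  define m where "m = min 0 (i0 - N)"
  define B where "B = Max (f ` {m..max i0 0})"
  have "f (m + int k) \<le> B" for k
  proof (induction k rule: less_induct)
    case (less k)
    show ?case
    proof (cases "m + int k \<ge> i0")
      case True
      then have "f (m + int k) = f (m + int k - N)" using N(2) by blast
      moreover have "m + int k - N = m + int (k - nat N)" "k - nat N < k"
        using True N(1) unfolding m_def by auto
      ultimately show ?thesis using less.IH by metis
    next
      case False
      then show ?thesis unfolding B_def by (intro Max_ge) auto
    qed
  qed
  then have "f i \<le> B" if "i \<ge> 0" for i
  proof -
    have "i = m + int (nat (i - m))" using that unfolding m_def by auto
    then show ?thesis using \<open>\<And>k. f (m + int k) \<le> B\<close> by metis
  qed
  then show ?thesis by blast
qed

text \<open>Far out on the ray the step from \<open>t\<close> to \<open>t + 1\<close> raises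
  \<open>L\<close> by \<Lambda> and keeps \<open>P\<close>, so it is a bijection between the level
  sets of \<open>i - \<Lambda>\<close> and \<open>i\<close> for large \<open>i\<close>. The period
  is \<Lambda>.\<close>

lemma eventually_periodic_card_ray:
  fixes L :: "int \<Rightarrow> int"
  assumes "eventually (\<lambda>t. P t = b) at_top" "eventually (\<lambda>t. L t = \<Lambda> * t + c) at_top" "\<Lambda> \<ge> 1"
  shows "eventually_periodic (\<lambda>i. card {t. 0 \<le> t \<and> P t \<and> L t = i})"
proof -
  have "eventually (\<lambda>t. P t = b \<and> L t = \<Lambda> * t + c \<and> t \<ge> 0) at_top"
    using assms(1,2) eventually_ge_at_top[of 0] by eventually_elim auto
  then obtain T where T: "\<And>t. t \<ge> T \<Longrightarrow> P t = b \<and> L t = \<Lambda> * t + c \<and> t \<ge> 0"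
    unfolding eventually_at_top_linorder by blast
  \<comment> \<open>Levels above \<open>M\<close> are not attained on the initial segment, so they
    are attained only where the eventual formulas hold. Below, both \<open>i\<close> and
    \<open>i - \<Lambda>\<close> exceed \<open>M\<close>.\<close>
  define M where "M = Max (L ` {0..T})"
  have big: "t > T" if "0 \<le> t" "L t > M" for t
  proof (rule ccontr)
    assume "\<not> t > T"
    then have "L t \<le> M" unfolding M_def using that by (intro Max_ge) auto
    then show False using that by simp
  qed
  have "card {t. 0 \<le> t \<and> P t \<and> L t = i} = card {t. 0 \<le> t \<and> P t \<and> L t = i - \<Lambda>}"
    if i: "i \<ge> M + \<Lambda> + 1" for i
  proof -
    have "{t. 0 \<le> t \<and> P t \<and> L t = i} = (\<lambda>t. t + 1) ` {t. 0 \<le> t \<and> P t \<and> L t = i - \<Lambda>}"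
    proof (intro equalityI subsetI)
      fix t assume t: "t \<in> {t. 0 \<le> t \<and> P t \<and> L t = i}"
      then have "t > T" using big[of t] i assms(3) by simp
      then have "t - 1 \<in> {t. 0 \<le> t \<and> P t \<and> L t = i - \<Lambda>}"
        using t T[of t] T[of "t - 1"] by (auto simp: algebra_simps)
      then show "t \<in> (\<lambda>t. t + 1) ` {t. 0 \<le> t \<and> P t \<and> L t = i - \<Lambda>}"
        by (intro image_eqI[of _ _ "t - 1"]) auto
    next
      fix t assume "t \<in> (\<lambda>t. t + 1) ` {t. 0 \<le> t \<and> P t \<and> L t = i - \<Lambda>}"
      then obtain u where u: "t = u + 1" "0 \<le> u" "P u" "L u = i - \<Lambda>" by auto
      then have "u > T" using big[of u] i by simp
      then show "t \<in> {t. 0 \<le> t \<and> P t \<and> L t = i}"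
        using u T[of u] T[of t] by (auto simp: algebra_simps)
    qed
    then show ?thesis by (simp add: card_image)
  qed
  then show ?thesis unfolding eventually_periodic_def using assms(3) by blast
qed

text \<open>The line is cut into two rays: the map from \<open>t\<close> to \<open>- 1 - t\<close>
  sends the nonnegative integers exactly onto the negative ones. Finite level sets make the two
  cardinalities add up.\<close>

lemma eventually_periodic_card_line:
  fixes L :: "int \<Rightarrow> int"
  assumes "eventually (\<lambda>t. P t = b) at_top" "eventually (\<lambda>t. L t = \<Lambda> * t + c) at_top"
    and "eventually (\<lambda>t. P (- 1 - t) = b') at_top"
    and "eventually (\<lambda>t. L (- 1 - t) = \<Lambda> * t + c') at_top"
    and "\<Lambda> \<ge> 1" and fin: "\<And>i. finite {t. L t = i}"
  shows "eventually_periodic (\<lambda>i. card {t. P t \<and> L t = i})"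
proof -
  have eq: "card {t. P t \<and> L t = i} = card {t. 0 \<le> t \<and> P t \<and> L t = i}
      + card {t. 0 \<le> t \<and> P (- 1 - t) \<and> L (- 1 - t) = i}" for i
  proof -
    let ?S = "{t. 0 \<le> t \<and> P t \<and> L t = i}" and ?R = "{t. 0 \<le> t \<and> P (- 1 - t) \<and> L (- 1 - t) = i}"
    have un: "{t. P t \<and> L t = i} = ?S \<union> (\<lambda>t. - 1 - t) ` ?R"
    proof (intro equalityI subsetI)
      fix t assume t: "t \<in> {t. P t \<and> L t = i}"
      show "t \<in> ?S \<union> (\<lambda>t. - 1 - t) ` ?R"
      proof (cases "t \<ge> 0")
        case False
        then show ?thesis using t by (intro UnI2 image_eqI[of _ _ "- 1 - t"]) auto
      qed (use t in auto)
    qed auto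
    have "finite {t. P t \<and> L t = i}" by (rule finite_subset[OF _ fin[of i]]) blast
    then have "finite (?S \<union> (\<lambda>t. - 1 - t) ` ?R)" by (simp only: un)
    then have "finite ?S" "finite ((\<lambda>t. - 1 - t) ` ?R)" by (simp_all only: finite_Un)
    moreover have "?S \<inter> (\<lambda>t. - 1 - t) ` ?R = {}" by auto
    ultimately have "card {t. P t \<and> L t = i} = card ?S + card ((\<lambda>t. - 1 - t) ` ?R)"
      unfolding un by (rule card_Un_disjoint)
    moreover have "card ((\<lambda>t. - 1 - t) ` ?R) = card ?R" by (rule card_image) (auto simp: inj_on_def)
    ultimately show ?thesis by simp
  qed
  show ?thesis unfolding eq
    using eventually_periodic_add[OF eventually_periodic_card_ray[OF assms(1,2,5)]
        eventually_periodic_card_ray[OF assms(3,4,5)]] .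
qed

section \<open>Length and membership along lattice rays and lines\<close>

text \<open>Shi's length formula in lattice coordinates: with \<open>z = - x - y\<close> the terms
  are the absolute values of \<open>y - x\<close>, \<open>z - y\<close> and \<open>z - x\<close>,
  each shifted by an offset that depends only on the residue part.\<close>

fun len3 :: "int \<times> int \<times> int \<Rightarrow> int \<times> int \<Rightarrow> int" where
  "len3 (e1, e2, e3) (x, y) = \<bar>y - x + e1\<bar> + \<bar>- x - y - y + e2\<bar> + \<bar>- x - y - x + e3\<bar>"

lemma finite_len3_level: "finite {\<theta>. len3 e \<theta> = i}"
proof -
  obtain e1 e2 e3 where e: "e = (e1, e2, e3)" by (cases e)
  define B where "B = \<bar>i\<bar> + \<bar>e1\<bar> + \<bar>e2\<bar> + \<bar>e3\<bar>"
  \<comment> \<open>Two of the three differences suffice: \<open>3 * x\<close> is the difference of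
    \<open>2 * x + y\<close> and \<open>y - x\<close>, and both of these are bounded by
    \<open>B\<close>.\<close>
  have "{\<theta>. len3 e \<theta> = i} \<subseteq> {- 2 * B..2 * B} \<times> {- 2 * B..2 * B}"
  proof
    fix \<theta> assume *: "\<theta> \<in> {\<theta>. len3 e \<theta> = i}"
    obtain x y where xy: "\<theta> = (x, y)" by (cases \<theta>)
    have 1: "\<bar>y - x\<bar> \<le> B" using * unfolding B_def e xy by simp
    have 2: "\<bar>- x - y - x\<bar> \<le> B" using * unfolding B_def e xy by simp
    show "\<theta> \<in> {- 2 * B..2 * B} \<times> {- 2 * B..2 * B}" using 1 2 unfolding xy by auto
  qed
  then show ?thesis by (rule finite_subset) simp
qed

lemma eventually_abs_affine:
  fixes a b :: int
  shows "\<exists>c. eventually (\<lambda>t. \<bar>a + t * b\<bar> = \<bar>b\<bar> * t + c) at_top"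
proof -
  consider "b = 0" | "b > 0" | "b < 0" by linarith
  then show ?thesis
  proof cases
    case 1 then show ?thesis by (intro exI[of _ "\<bar>a\<bar>"]) simp
  next
    case 2
    have "\<bar>a + t * b\<bar> = \<bar>b\<bar> * t + a" if "t \<ge> \<bar>a\<bar>" for t
    proof -
      have "\<bar>a\<bar> * 1 \<le> t * b" using 2 that by (intro mult_mono) auto
      then show ?thesis using 2 by (auto simp: mult.commute)
    qed
    then show ?thesis unfolding eventually_at_top_linorder by blast
  next
    case 3
    have "\<bar>a + t * b\<bar> = \<bar>b\<bar> * t + (- a)" if "t \<ge> \<bar>a\<bar>" for t
    proof -
      have "\<bar>a\<bar> * 1 \<le> t * (- b)" using 3 that by (intro mult_mono) auto
      then show ?thesis using 3 by (auto simp: mult.commute)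
    qed
    then show ?thesis unfolding eventually_at_top_linorder by blast
  qed
qed

text \<open>The slope depends only on the direction and is even in it, so the two ends of a lattice
  line have the same slope and hence the same period.\<close>

lemma eventually_len3:
  "\<exists>c. eventually (\<lambda>t. len3 e (x + t * dx, y + t * dy) = len3 (0, 0, 0) (dx, dy) * t + c) at_top"
proof -
  obtain e1 e2 e3 where e: "e = (e1, e2, e3)" by (cases e)
  obtain c1 where c1: "eventually (\<lambda>t. \<bar>(y - x + e1) + t * (dy - dx)\<bar> = \<bar>dy - dx\<bar> * t + c1) at_top"
    using eventually_abs_affine by blast
  obtain c2 where c2: "eventually (\<lambda>t. \<bar>(- x - y - y + e2) + t * (- dx - dy - dy)\<bar>
      = \<bar>- dx - dy - dy\<bar> * t + c2) at_top"
    using eventually_abs_affine by blast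
  obtain c3 where c3: "eventually (\<lambda>t. \<bar>(- x - y - x + e3) + t * (- dx - dy - dx)\<bar>
      = \<bar>- dx - dy - dx\<bar> * t + c3) at_top"
    using eventually_abs_affine by blast
  have "eventually (\<lambda>t. len3 e (x + t * dx, y + t * dy)
      = len3 (0, 0, 0) (dx, dy) * t + (c1 + c2 + c3)) at_top"
    using c1 c2 c3
  proof eventually_elim
    case (elim t)
    have "len3 e (x + t * dx, y + t * dy) = \<bar>(y - x + e1) + t * (dy - dx)\<bar>
       + \<bar>(- x - y - y + e2) + t * (- dx - dy - dy)\<bar> + \<bar>(- x - y - x + e3) + t * (- dx - dy - dx)\<bar>"
      by (simp add: e algebra_simps)
    also have "\<dots> = len3 (0, 0, 0) (dx, dy) * t + (c1 + c2 + c3)"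
      unfolding elim by (simp add: algebra_simps)
    finally show ?case .
  qed
  then show ?thesis by blast
qed

lemma len3_ge_1: "(dx, dy) \<noteq> (0, 0) \<Longrightarrow> len3 (0, 0, 0) (dx, dy) \<ge> 1"
  by auto

text \<open>This is all that the counting needs to know about a set cut out by finitely many
  half-planes.\<close>

definition eventually_const_on_rays :: "(int \<times> int) set \<Rightarrow> bool" where
  "eventually_const_on_rays A \<longleftrightarrow>
     (\<forall>x y dx dy. \<exists>b. eventually (\<lambda>t. ((x + t * dx, y + t * dy) \<in> A) = b) at_top)"

text \<open>Dividing \<open>a\<close> and \<open>b\<close> by their gcd gives the primitive
  direction \<open>(- b', a')\<close>, whose integer multiples reach every lattice point of the
  line.\<close>

lemma lattice_line_param:
  fixes a b :: int
  assumes "(a, b) \<noteq> (0, 0)"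
  shows "\<exists>dx dy. (dx, dy) \<noteq> (0, 0) \<and>
    (\<forall>x y x' y'. a * x + b * y = a * x' + b * y' \<longleftrightarrow> (\<exists>t. x = x' + t * dx \<and> y = y' + t * dy))"
proof -
  define g where "g = gcd a b"
  have g0: "g \<noteq> 0" using assms unfolding g_def by auto
  obtain a' b' where ab: "a = g * a'" "b = g * b'" unfolding g_def by (meson dvdE gcd_dvd1 gcd_dvd2)
  obtain r q where "r * a + q * b = g" unfolding g_def using bezout_int by blast
  then have "g * (r * a' + q * b') = g * 1" unfolding ab by (simp add: algebra_simps)
  then have rq: "r * a' + q * b' = 1" using g0 by simp
  show ?thesis
  proof (rule exI[of _ "- b'"], rule exI[of _ "a'"], intro conjI allI iffI)
    show "(- b', a') \<noteq> (0, 0)" using assms ab by auto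
  next
    fix x y x' y' assume "a * x + b * y = a * x' + b * y'"
    then have "g * (a' * (x - x') + b' * (y - y')) = g * 0" unfolding ab by (simp add: algebra_simps)
    then have *: "a' * (x - x') + b' * (y - y') = 0" using g0 by simp
    \<comment> \<open>The parameter is read off with the Bezout coefficients: given the equation
      marked \<open>*\<close>, both differences are combinations of it and of
      \<open>r * a' + q * b' = 1\<close>.\<close>
    define t where "t = r * (y - y') - q * (x - x')"
    have "x - x' = (r * a' + q * b') * (x - x') - r * (a' * (x - x') + b' * (y - y'))"
      by (simp only: rq *) simp
    then have "x = x' + t * (- b')" unfolding t_def by (simp add: algebra_simps)
    moreover have "y - y' = (r * a' + q * b') * (y - y') - q * (a' * (x - x') + b' * (y - y'))"
      by (simp only: rq *) simp
    then have "y = y' + t * a'" unfolding t_def by (simp add: algebra_simps)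
    ultimately show "\<exists>t. x = x' + t * (- b') \<and> y = y' + t * a'" by blast
  next
    fix x y x' y' assume "\<exists>t. x = x' + t * (- b') \<and> y = y' + t * a'"
    then show "a * x + b * y = a * x' + b * y'" unfolding ab by (auto simp: algebra_simps)
  qed
qed

text \<open>A lattice line is a copy of the integers. At both of its ends membership in
  \<open>A\<close> is eventually constant and the length grows linearly with the same positive
  slope.\<close>

lemma eventually_periodic_card_subset_line:
  assumes "(a, b) \<noteq> (0, 0)" "eventually_const_on_rays A" "A \<subseteq> {(x, y). a * x + b * y = c}"
  shows "eventually_periodic (\<lambda>i. card {\<theta> \<in> A. len3 e \<theta> = i})"
proof (cases "A = {}")
  case True
  then show ?thesis by (simp add: eventually_periodic_zero)
next
  case False
  then obtain x y where xy: "(x, y) \<in> A" by auto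
  obtain dx dy where d: "(dx, dy) \<noteq> (0, 0)" and
    line: "\<And>u v. a * u + b * v = a * x + b * y \<longleftrightarrow> (\<exists>t. u = x + t * dx \<and> v = y + t * dy)"
    using lattice_line_param[OF assms(1)] by blast
  define pt where "pt t = (x + t * dx, y + t * dy)" for t
  have inj: "inj_on pt X" for X using d unfolding inj_on_def pt_def by auto
  have cov: "\<theta> \<in> range pt" if "\<theta> \<in> A" for \<theta>
  proof -
    obtain u v where uv: "\<theta> = (u, v)" by (cases \<theta>)
    have "a * u + b * v = c" "a * x + b * y = c" using assms(3) that xy uv by auto
    then show ?thesis using line[of u v] unfolding uv pt_def by auto
  qed
  have card: "card {\<theta> \<in> A. len3 e \<theta> = i} = card {t. pt t \<in> A \<and> len3 e (pt t) = i}" for i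
  proof -
    have "{\<theta> \<in> A. len3 e \<theta> = i} = pt ` {t. pt t \<in> A \<and> len3 e (pt t) = i}"
      using cov by blast
    then show ?thesis by (simp add: card_image[OF inj])
  qed
  have fin: "finite {t. len3 e (pt t) = i}" for i
    using finite_vimageI[OF finite_len3_level[of e i] inj[of UNIV]] by (simp add: vimage_def)
  have neg: "pt (- 1 - t) = ((x - dx) + t * (- dx), (y - dy) + t * (- dy))" for t
    unfolding pt_def by (simp add: algebra_simps)
  obtain b1 where b1: "eventually (\<lambda>t. (pt t \<in> A) = b1) at_top"
    using assms(2) unfolding eventually_const_on_rays_def pt_def by blast
  obtain b2 where b2: "eventually (\<lambda>t. (pt (- 1 - t) \<in> A) = b2) at_top"
    using assms(2) unfolding eventually_const_on_rays_def neg by blast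
  obtain c1 where c1: "eventually (\<lambda>t. len3 e (pt t) = len3 (0, 0, 0) (dx, dy) * t + c1) at_top"
    using eventually_len3 unfolding pt_def by blast
  have sym: "len3 (0, 0, 0) (- dx, - dy) = len3 (0, 0, 0) (dx, dy)" by simp
  obtain c2 where c2: "eventually (\<lambda>t. len3 e (pt (- 1 - t)) = len3 (0, 0, 0) (dx, dy) * t + c2) at_top"
    using eventually_len3[of e "x - dx" "- dx" "y - dy" "- dy"] unfolding neg sym by blast
  show ?thesis unfolding card
    by (rule eventually_periodic_card_line[OF b1 c1 b2 c2 len3_ge_1[OF d] fin])
qed

lemma eventually_affine_sign:
  fixes a b :: int
  shows "\<exists>s. eventually (\<lambda>t. (0 \<le> a + t * b) = s) at_top"
proof -
  consider "b = 0" | "b > 0" | "b < 0" by linarith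
  then show ?thesis
  proof cases
    case 1 then show ?thesis by simp
  next
    case 2
    have "(0 \<le> a + t * b) = True" if "t \<ge> \<bar>a\<bar>" for t
    proof -
      have "\<bar>a\<bar> * 1 \<le> t * b" using 2 that by (intro mult_mono) auto
      then show ?thesis by auto
    qed
    then show ?thesis unfolding eventually_at_top_linorder by blast
  next
    case 3
    have "(0 \<le> a + t * b) = False" if "t \<ge> \<bar>a\<bar> + 1" for t
    proof -
      have "(\<bar>a\<bar> + 1) * 1 \<le> t * (- b)" using 3 that by (intro mult_mono) auto
      then show ?thesis by auto
    qed
    then show ?thesis unfolding eventually_at_top_linorder by blast
  qed
qed

lemma eventually_const_on_rays_Int_line:
  assumes "eventually_const_on_rays A"
  shows "eventually_const_on_rays (A \<inter> {(x, y). a * x + b * y = c})" (is ?I)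
    and "eventually_const_on_rays (A - {(x, y). a * x + b * y = c})" (is ?D)
proof -
  have *: "\<exists>s. eventually (\<lambda>t. (a * (x + t * dx) + b * (y + t * dy) = c) = s) at_top" for x y dx dy
  proof -
    \<comment> \<open>An equation is a pair of opposite weak inequalities, and each of them is
      eventually decided along the ray.\<close>
    obtain s1 where s1: "eventually (\<lambda>t. (0 \<le> (a * x + b * y - c) + t * (a * dx + b * dy)) = s1) at_top"
      using eventually_affine_sign by blast
    obtain s2 where s2: "eventually (\<lambda>t. (0 \<le> - (a * x + b * y - c) + t * (- (a * dx + b * dy))) = s2) at_top"
      using eventually_affine_sign by blast
    have "eventually (\<lambda>t. (a * (x + t * dx) + b * (y + t * dy) = c) = (s1 \<and> s2)) at_top"
      using s1 s2 by eventually_elim (auto simp: algebra_simps)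
    then show ?thesis by blast
  qed
  show ?I unfolding eventually_const_on_rays_def
  proof (intro allI)
    fix x y dx dy
    obtain s where "eventually (\<lambda>t. (a * (x + t * dx) + b * (y + t * dy) = c) = s) at_top" using * by blast
    moreover obtain s' where "eventually (\<lambda>t. ((x + t * dx, y + t * dy) \<in> A) = s') at_top"
      using assms unfolding eventually_const_on_rays_def by blast
    ultimately have "eventually (\<lambda>t. ((x + t * dx, y + t * dy)
        \<in> A \<inter> {(x, y). a * x + b * y = c}) = (s' \<and> s)) at_top"
      by eventually_elim simp
    then show "\<exists>b'. eventually (\<lambda>t. ((x + t * dx, y + t * dy)
        \<in> A \<inter> {(x, y). a * x + b * y = c}) = b') at_top" by blast
  qed
  show ?D unfolding eventually_const_on_rays_def
  proof (intro allI)
    fix x y dx dy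
    obtain s where "eventually (\<lambda>t. (a * (x + t * dx) + b * (y + t * dy) = c) = s) at_top" using * by blast
    moreover obtain s' where "eventually (\<lambda>t. ((x + t * dx, y + t * dy) \<in> A) = s') at_top"
      using assms unfolding eventually_const_on_rays_def by blast
    ultimately have "eventually (\<lambda>t. ((x + t * dx, y + t * dy)
        \<in> A - {(x, y). a * x + b * y = c}) = (s' \<and> \<not> s)) at_top"
      by eventually_elim simp
    then show "\<exists>b'. eventually (\<lambda>t. ((x + t * dx, y + t * dy)
        \<in> A - {(x, y). a * x + b * y = c}) = b') at_top" by blast
  qed
qed

text \<open>Induction on the lines: the part of \<open>A\<close> on one line is counted separately,
  and the rest lies on the remaining lines. Removing the line first avoids counting intersection
  points twice.\<close>

lemma eventually_periodic_card_subset_lines: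
  assumes "finite Ls" "\<forall>(a, b, c)\<in>Ls. (a, b) \<noteq> (0, 0)" "eventually_const_on_rays A"
    and "\<forall>(x, y)\<in>A. \<exists>(a, b, c)\<in>Ls. a * x + b * y = c"
  shows "eventually_periodic (\<lambda>i. card {\<theta> \<in> A. len3 e \<theta> = i})"
  using assms
proof (induction Ls arbitrary: A)
  case empty
  then have "A = {}" by auto
  then show ?case by (simp add: eventually_periodic_zero)
next
  case (insert l Ls)
  obtain a b c where l: "l = (a, b, c)" by (cases l)
  let ?l = "{(x, y). a * x + b * y = c}"
  have "card {\<theta> \<in> A. len3 e \<theta> = i}
      = card {\<theta> \<in> A \<inter> ?l. len3 e \<theta> = i} + card {\<theta> \<in> A - ?l. len3 e \<theta> = i}" for i
  proof -
    have fin: "finite {\<theta> \<in> B. len3 e \<theta> = i}" for B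
      by (rule finite_subset[OF _ finite_len3_level[of e i]]) blast
    have "{\<theta> \<in> A. len3 e \<theta> = i} = {\<theta> \<in> A \<inter> ?l. len3 e \<theta> = i} \<union> {\<theta> \<in> A - ?l. len3 e \<theta> = i}"
      and "{\<theta> \<in> A \<inter> ?l. len3 e \<theta> = i} \<inter> {\<theta> \<in> A - ?l. len3 e \<theta> = i} = {}"
      by blast+
    then show ?thesis
      using card_Un_disjoint[OF fin fin, of "A \<inter> ?l" "A - ?l"] by simp
  qed
  moreover have "eventually_periodic (\<lambda>i. card {\<theta> \<in> A \<inter> ?l. len3 e \<theta> = i})"
    using insert.prems(1) l
    by (intro eventually_periodic_card_subset_line[of a b _ c]
        eventually_const_on_rays_Int_line(1)[OF insert.prems(2)]) auto
  moreover have "eventually_periodic (\<lambda>i. card {\<theta> \<in> A - ?l. len3 e \<theta> = i})"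
  proof (rule insert.IH)
    show "\<forall>(x, y)\<in>A - ?l. \<exists>(a, b, c)\<in>Ls. a * x + b * y = c"
      using insert.prems(3) l by fastforce
  qed (use insert.prems eventually_const_on_rays_Int_line(2) in auto)
  ultimately show ?case using eventually_periodic_add by simp
qed

section \<open>Words for affine permutations\<close>

lemma word_prod_simps [simp]:
  "word_prod n [] = id" "word_prod n (i # ws) = gen n i \<circ> word_prod n ws"
  unfolding word_prod_def by simp_all

lemma word_prod_append: "word_prod n (us @ vs) = word_prod n us \<circ> word_prod n vs"
  by (induction us) (auto simp: comp_assoc)

lemma word_prod_snoc: "word_prod n (ws @ [i]) = word_prod n ws \<circ> gen n i"
  by (simp add: word_prod_append)

lemma gen_invol:
  assumes "n \<ge> 2"
  shows "gen n i (gen n i j) = j"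
proof -
  have 1: "(int i + 1) mod int n \<noteq> int i mod int n"
  proof
    assume "(int i + 1) mod int n = int i mod int n"
    then have "int n dvd (int i + 1) - int i" by (simp only: mod_eq_dvd_iff)
    then show False using assms by (simp add: zdvd1_eq)
  qed
  have 2: "(j + 1) mod int n = (int i + 1) mod int n" if "j mod int n = int i mod int n"
    using that by (rule mod_add_cong) simp
  have 3: "(j - 1) mod int n = int i mod int n" if "j mod int n = (int i + 1) mod int n"
    using mod_diff_cong[OF that refl, of 1] by simp
  show ?thesis using 1 2 3 unfolding gen_def by auto
qed

lemma gen_add_period: "gen n i (j + int n) = gen n i j + int n"
  unfolding gen_def by simp

text \<open>The window starts at \<open>int i\<close> so that the swapped pair lies inside it; in
  \<open>{1..int n}\<close> the generator with index 0 would wrap around.\<close>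

lemma gen_on_window:
  assumes "n \<ge> 2" "j \<in> {int i..int i + int n - 1}"
  shows "gen n i j = (if j = int i then int i + 1 else if j = int i + 1 then int i else j)"
proof -
  have *: "j mod int n = k mod int n \<longleftrightarrow> j = k" if "k \<in> {int i..int i + int n - 1}" for k
  proof
    assume "j mod int n = k mod int n"
    then have "int n dvd j - k" by (simp only: mod_eq_dvd_iff)
    moreover have "\<bar>j - k\<bar> < int n" using assms that by auto
    ultimately show "j = k" using dvd_imp_le_int[of "j - k" "int n"] by fastforce
  qed simp
  show ?thesis unfolding gen_def using assms *[of "int i"] *[of "int i + 1"] by auto
qed

lemma sum_ints_choose: "(\<Sum>i\<in>{1..int n}. i) = int ((n + 1) choose 2)"
proof (induction n)
  case (Suc n)
  have "{1..int (Suc n)} = insert (int (Suc n)) {1..int n}" by auto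
  then show ?case using Suc by (simp add: numeral_2_eq_2)
qed simp

text \<open>Displacements \<open>w i - i\<close> are periodic, unlike values, so their sum may be
  taken over any window of length \<open>n\<close>.\<close>

lemma affine_perm_alt:
  "affine_perm n w \<longleftrightarrow> bij w \<and> (\<forall>i. w (i + int n) = w i + int n) \<and> (\<Sum>i\<in>{1..int n}. w i - i) = 0"
  unfolding affine_perm_def by (auto simp: sum_subtractf sum_ints_choose)

lemma sum_periodic_window:
  fixes F :: "int \<Rightarrow> int"
  assumes "\<And>j. F (j + int n) = F j"
  shows "(\<Sum>j\<in>{int a..int a + int n - 1}. F j) = (\<Sum>j\<in>{1..int n}. F j)"
proof -
  have step: "(\<Sum>j\<in>{c + 1..c + 1 + int n - 1}. F j) = (\<Sum>j\<in>{c..c + int n - 1}. F j)" for c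
  proof (cases "n = 0")
    case False
    have "{c + 1..c + 1 + int n - 1} = insert (c + int n) {c + 1..c + int n - 1}"
      and "{c..c + int n - 1} = insert c {c + 1..c + int n - 1}" using False by auto
    then show ?thesis using assms[of c] by simp
  qed simp
  have "(\<Sum>j\<in>{int a..int a + int n - 1}. F j) = (\<Sum>j\<in>{0..0 + int n - 1}. F j)"
  proof (induction a)
    case (Suc a)
    show ?case using step[of "int a"] Suc by (simp add: add.commute)
  qed simp
  then show ?thesis using step[of 0] by simp
qed

lemma sum_window_split:
  fixes F :: "int \<Rightarrow> int"
  assumes "n \<ge> 2"
  shows "(\<Sum>j\<in>{int i..int i + int n - 1}. F j)
    = F (int i) + F (int i + 1) + (\<Sum>j\<in>{int i + 2..int i + int n - 1}. F j)"
proof -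
  have "{int i..int i + int n - 1} = insert (int i) (insert (int i + 1) {int i + 2..int i + int n - 1})"
    using assms by auto
  then show ?thesis by simp
qed

lemma affine_perm_shift_mult:
  assumes "\<forall>i. w (i + int n) = w i + int n"
  shows "w (j + k * int n) = w j + k * int n"
proof -
  have nat: "w (j + int m * int n) = w j + int m * int n" for j m
  proof (induction m)
    case (Suc m)
    have "w (j + int (Suc m) * int n) = w ((j + int m * int n) + int n)" by (simp add: algebra_simps)
    also have "\<dots> = w (j + int m * int n) + int n" using assms by blast
    also have "\<dots> = w j + int (Suc m) * int n" unfolding Suc by (simp add: algebra_simps)
    finally show ?case .
  qed simp
  show ?thesis
  proof (cases "k \<ge> 0")
    case True
    then show ?thesis using nat[of j "nat k"] by simp
  next
    case False
    then show ?thesis using nat[of "j + k * int n" "nat (- k)"] by simp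
  qed
qed

text \<open>Over the window starting at \<open>int i\<close> only two summands change. With
  \<open>F j v = v - j\<close> this preserves the normalization of affine permutations; with the
  square of \<open>v - j\<close> it gives the measure for the induction on words.\<close>

lemma sum_window_comp_gen:
  fixes F :: "int \<Rightarrow> int \<Rightarrow> int"
  assumes n: "n \<ge> 2" and w: "\<forall>i. w (i + int n) = w i + int n"
    and F: "\<And>j v. F (j + int n) (v + int n) = F j v"
  shows "(\<Sum>j\<in>{1..int n}. F j (w (gen n i j))) - (\<Sum>j\<in>{1..int n}. F j (w j))
    = F (int i) (w (int i + 1)) + F (int i + 1) (w (int i))
      - F (int i) (w (int i)) - F (int i + 1) (w (int i + 1))"
proof -
  let ?R = "{int i + 2..int i + int n - 1}"
  have "(\<Sum>j\<in>{1..int n}. F j (w (gen n i j))) = (\<Sum>j\<in>{int i..int i + int n - 1}. F j (w (gen n i j)))"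
    by (rule sum_periodic_window[symmetric]) (simp add: gen_add_period w F)
  also have "\<dots> = F (int i) (w (gen n i (int i))) + F (int i + 1) (w (gen n i (int i + 1)))
      + (\<Sum>j\<in>?R. F j (w (gen n i j)))"
    by (rule sum_window_split[OF n])
  also have "(\<Sum>j\<in>?R. F j (w (gen n i j))) = (\<Sum>j\<in>?R. F j (w j))"
    by (rule sum.cong) (auto simp: gen_on_window[OF n])
  finally have 1: "(\<Sum>j\<in>{1..int n}. F j (w (gen n i j)))
    = F (int i) (w (int i + 1)) + F (int i + 1) (w (int i)) + (\<Sum>j\<in>?R. F j (w j))"
    using n by (simp add: gen_on_window)
  have "(\<Sum>j\<in>{1..int n}. F j (w j)) = (\<Sum>j\<in>{int i..int i + int n - 1}. F j (w j))"
    by (rule sum_periodic_window[symmetric]) (simp add: w F)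
  also have "\<dots> = F (int i) (w (int i)) + F (int i + 1) (w (int i + 1)) + (\<Sum>j\<in>?R. F j (w j))"
    by (rule sum_window_split[OF n])
  finally show ?thesis using 1 by simp
qed

lemma affine_perm_comp_gen:
  assumes "n \<ge> 2" "affine_perm n w"
  shows "affine_perm n (w \<circ> gen n i)"
proof -
  have w: "bij w" "\<forall>i. w (i + int n) = w i + int n" "(\<Sum>i\<in>{1..int n}. w i - i) = 0"
    using assms(2) unfolding affine_perm_alt by auto
  have "bij (gen n i)" using gen_invol[OF assms(1)] by (rule involuntory_imp_bij)
  then have "bij (w \<circ> gen n i)" using w(1) by (rule bij_comp)
  moreover have "(\<Sum>j\<in>{1..int n}. (w \<circ> gen n i) j - j) = 0"
    using sum_window_comp_gen[OF assms(1) w(2), of "\<lambda>j v. v - j" i] w(3) by simp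
  ultimately show ?thesis unfolding affine_perm_alt using w(2) by (simp add: gen_add_period)
qed

text \<open>Without descents the displacement \<open>D\<close> is nondecreasing. It is also
  periodic, hence constant, and the normalization makes the constant 0.\<close>

lemma affine_perm_no_descent:
  assumes "n \<ge> 1" "affine_perm n w" "\<And>i. i < n \<Longrightarrow> w (int i) \<le> w (int i + 1)"
  shows "w = id"
proof -
  have w: "bij w" "\<forall>i. w (i + int n) = w i + int n" "(\<Sum>i\<in>{1..int n}. w i - i) = 0"
    using assms(2) unfolding affine_perm_alt by auto
  define D where "D j = w j - j" for j
  have step: "D j \<le> D (j + 1)" for j
  proof -
    define r where "r = j mod int n"
    have j: "j = r + (j div int n) * int n" unfolding r_def by simp
    have r: "0 \<le> r" "r < int n" using assms(1) unfolding r_def by simp_all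
    then have "w r \<le> w (r + 1)" using assms(3)[of "nat r"] by auto
    moreover have "w r \<noteq> w (r + 1)" using w(1) by (simp add: bij_def inj_eq)
    moreover have "w j = w r + (j div int n) * int n"
      using affine_perm_shift_mult[OF w(2), of r "j div int n"] j by simp
    moreover have "w (j + 1) = w (r + 1) + (j div int n) * int n"
      using affine_perm_shift_mult[OF w(2), of "r + 1" "j div int n"] j by (simp add: algebra_simps)
    ultimately show ?thesis unfolding D_def by simp
  qed
  have mono: "D j \<le> D (j + int k)" for j k
  proof (induction k)
    case (Suc k)
    then show ?case using step[of "j + int k"] by (simp add: algebra_simps)
  qed simp
  have "D (j + 1) = D j" for j
  proof -
    have "D (j + 1) \<le> D (j + 1 + int (n - 1))" by (rule mono)
    also have "\<dots> = D (j + int n)" using assms(1) by (simp add: of_nat_diff)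
    also have "\<dots> = D j" using w(2) unfolding D_def by simp
    finally show ?thesis using step[of j] by simp
  qed
  then have up: "D (j + int k) = D j" for j k
    by (induction k) (simp_all add: algebra_simps, metis add.assoc add.commute)
  have const: "D j = D 0" for j
  proof (cases "j \<ge> 0")
    case True
    then show ?thesis using up[of 0 "nat j"] by simp
  next
    case False
    then show ?thesis using up[of j "nat (- j)"] by simp
  qed
  have "(\<Sum>i\<in>{1..int n}. w i - i) = (\<Sum>i\<in>{1..int n}. D 0)"
    using const unfolding D_def by (intro sum.cong) auto
  then have "D 0 = 0" using w(3) assms(1) by simp
  then show ?thesis using const unfolding D_def by (auto simp: fun_eq_iff)
qed

text \<open>Induction on the sum of squared displacements over a window. Swapping at a descent
  lowers it by twice the drop in value, and without a descent \<open>w\<close> is the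
  identity.\<close>

lemma affine_perm_word:
  assumes n: "n \<ge> 2" and "affine_perm n w"
  shows "\<exists>ws. set ws \<subseteq> {0..<n} \<and> w = word_prod n ws"
  using assms(2)
proof (induction "nat (\<Sum>j\<in>{1..int n}. (w j - j)\<^sup>2)" arbitrary: w rule: less_induct)
  case less
  have w: "\<forall>i. w (i + int n) = w i + int n" using less.prems unfolding affine_perm_alt by auto
  show ?case
  proof (cases "\<exists>i<n. w (int i) > w (int i + 1)")
    case True
    then obtain i where i: "i < n" "w (int i) > w (int i + 1)" by blast
    let ?F = "\<lambda>j v. (v - j)\<^sup>2 :: int"
    have "(\<Sum>j\<in>{1..int n}. ?F j (w (gen n i j))) - (\<Sum>j\<in>{1..int n}. ?F j (w j))
        = 2 * (w (int i + 1) - w (int i))"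
      using sum_window_comp_gen[OF n w, of ?F i] by (simp add: power2_eq_square algebra_simps)
    then have "(\<Sum>j\<in>{1..int n}. ((w \<circ> gen n i) j - j)\<^sup>2) < (\<Sum>j\<in>{1..int n}. (w j - j)\<^sup>2)"
      using i(2) by simp
    moreover have "(\<Sum>j\<in>{1..int n}. ((w \<circ> gen n i) j - j)\<^sup>2) \<ge> 0" by (intro sum_nonneg) simp
    ultimately obtain ws where ws: "set ws \<subseteq> {0..<n}" "w \<circ> gen n i = word_prod n ws"
      using less.hyps[OF _ affine_perm_comp_gen[OF n less.prems, of i]] by auto
    have "w = (w \<circ> gen n i) \<circ> gen n i" using gen_invol[OF n] by (simp add: fun_eq_iff)
    also have "\<dots> = word_prod n (ws @ [i])" unfolding ws(2) word_prod_snoc ..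
    finally show ?thesis using ws(1) i(1) by (intro exI[of _ "ws @ [i]"]) auto
  next
    case False
    then have "w = id" using affine_perm_no_descent[OF _ less.prems] n by force
    then show ?thesis by (intro exI[of _ "[]"]) simp
  qed
qed

lemma aff_length_word:
  assumes "n \<ge> 2" "affine_perm n w"
  shows "\<exists>ws. length ws = aff_length n w \<and> set ws \<subseteq> {0..<n} \<and> w = word_prod n ws"
  unfolding aff_length_def
  by (rule LeastI_ex) (use affine_perm_word[OF assms] in blast)

lemma aff_length_le: "set ws \<subseteq> {0..<n} \<Longrightarrow> aff_length n (word_prod n ws) \<le> length ws"
  unfolding aff_length_def by (rule Least_le) blast

text \<open>Since \<open>card\<close> is 0 on infinite sets, finiteness is what lets the
  coefficients count permutations. There are only finitely many words of a given length.\<close>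

lemma finite_aff_length_level:
  assumes "n \<ge> 2"
  shows "finite {w. affine_perm n w \<and> int (aff_length n w) = i}"
proof (rule finite_subset)
  show "{w. affine_perm n w \<and> int (aff_length n w) = i}
    \<subseteq> word_prod n ` {ws. set ws \<subseteq> {0..<n} \<and> length ws = nat i}"
    using aff_length_word[OF assms] by fastforce
  show "finite (word_prod n ` {ws. set ws \<subseteq> {0..<n} \<and> length ws = nat i})"
    by (intro finite_imageI finite_lists_length_eq) simp
qed

section \<open>Shi's length formula in size 3\<close>

text \<open>Shi's formula sums the absolute values of the floors of \<open>(w j - w i) / n\<close>
  over the pairs \<open>i < j\<close> in a window; \<open>div\<close> is this floor for
  \<open>n = 3\<close>.\<close>

definition shi3 :: "(int \<Rightarrow> int) \<Rightarrow> int" where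
  "shi3 w = \<bar>(w 2 - w 1) div 3\<bar> + \<bar>(w 3 - w 2) div 3\<bar> + \<bar>(w 3 - w 1) div 3\<bar>"

lemma minus_div_3: "\<not> 3 dvd d \<Longrightarrow> (- d) div 3 = - (d div 3) - (1::int)"
  by presburger

lemma affine_perm_3_distinct:
  assumes "affine_perm 3 w" "i \<in> {1..3}" "j \<in> {1..3}" "i \<noteq> j"
  shows "\<not> 3 dvd w i - w j"
proof
  assume "3 dvd w i - w j"
  then obtain k where k: "w i = w j + k * 3" by (metis dvdE diff_add_cancel add.commute mult.commute)
  have w: "bij w" "\<forall>i. w (i + int 3) = w i + int 3" using assms(1) unfolding affine_perm_alt by auto
  have "w i = w (j + k * 3)" using k affine_perm_shift_mult[OF w(2), of j k] by simp
  then have "i = j + k * 3" using w(1) by (simp add: bij_def inj_eq)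
  then show False using assms(2-4) by auto
qed

text \<open>A generator exchanges two of the quotients up to sign and floor corrections, and
  replaces the third by \<open>- q - 1\<close>, or by \<open>1 - q3\<close> for
  \<open>i = 0\<close>. The absolute value of that one changes by exactly 1, upwards at an ascent
  and downwards at a descent.\<close>

lemma shi3_comp_gen:
  assumes "affine_perm 3 w" "i < 3"
  shows "shi3 (w \<circ> gen 3 i) = shi3 w + (if w (int i) < w (int i + 1) then 1 else - 1)"
proof -
  have per: "\<forall>i. w (i + int 3) = w i + int 3" using assms(1) unfolding affine_perm_alt by auto
  define x y z where xyz: "x = w 1" "y = w 2" "z = w 3"
  have w0: "w 0 = z - 3" "w 4 = x + 3"
    using per[rule_format, of 0] per[rule_format, of 1] xyz by simp_all
  have d: "\<not> 3 dvd y - x" "\<not> 3 dvd z - y" "\<not> 3 dvd z - x"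
    using affine_perm_3_distinct[OF assms(1)] xyz by simp_all
  define q1 q2 q3 where q: "q1 = (y - x) div 3" "q2 = (z - y) div 3" "q3 = (z - x) div 3"
  have r: "(x - y) div 3 = - q1 - 1" "(y - z) div 3 = - q2 - 1" "(x - z) div 3 = - q3 - 1"
    using minus_div_3[OF d(1)] minus_div_3[OF d(2)] minus_div_3[OF d(3)] unfolding q by simp_all
  have w: "shi3 w = \<bar>q1\<bar> + \<bar>q2\<bar> + \<bar>q3\<bar>" unfolding shi3_def xyz q ..
  consider "i = 0" | "i = 1" | "i = 2" using assms(2) by linarith
  then show ?thesis
  proof cases
    case 1
    \<comment> \<open>The swapped pair crosses the window boundary here, so the new window reads
      \<open>z - 3\<close>, \<open>y\<close>, \<open>x + 3\<close>.\<close>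
    have g: "gen 3 0 1 = 0" "gen 3 0 2 = 2" "gen 3 0 3 = 4" by (simp_all add: gen_def)
    have "(y - (z - 3)) div 3 = (y - z) div 3 + 1" "(x + 3 - y) div 3 = (x - y) div 3 + 1"
      "(x + 3 - (z - 3)) div 3 = (x - z) div 3 + 2" by presburger+
    then have "shi3 (w \<circ> gen 3 i) = \<bar>- q2\<bar> + \<bar>- q1\<bar> + \<bar>1 - q3\<bar>"
      unfolding r by (simp add: shi3_def 1 g w0 flip: xyz(2))
    moreover have "z - 3 < x \<longleftrightarrow> q3 \<le> 0" using d(3) unfolding q by presburger
    moreover have "w (int i) = z - 3" "w (int i + 1) = x" using w0 xyz by (simp_all add: 1)
    ultimately show ?thesis using w by simp
  next
    case 2
    have g: "gen 3 i 1 = 2" "gen 3 i 2 = 1" "gen 3 i 3 = 3" by (simp_all add: gen_def 2)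
    have "shi3 (w \<circ> gen 3 i) = \<bar>- q1 - 1\<bar> + \<bar>q3\<bar> + \<bar>q2\<bar>"
      unfolding r[symmetric] by (simp add: shi3_def g q flip: xyz)
    moreover have "x < y \<longleftrightarrow> q1 \<ge> 0" using d(1) unfolding q by presburger
    moreover have "w (int i) = x" "w (int i + 1) = y" using xyz by (simp_all add: 2)
    ultimately show ?thesis using w by simp
  next
    case 3
    have g: "gen 3 i 1 = 1" "gen 3 i 2 = 3" "gen 3 i 3 = 2" by (simp_all add: gen_def 3)
    have "shi3 (w \<circ> gen 3 i) = \<bar>q3\<bar> + \<bar>- q2 - 1\<bar> + \<bar>q1\<bar>"
      unfolding r[symmetric] by (simp add: shi3_def g q flip: xyz)
    moreover have "y < z \<longleftrightarrow> q2 \<ge> 0" using d(2) unfolding q by presburger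
    moreover have "w (int i) = y" "w (int i + 1) = z" using xyz by (simp_all add: 3)
    ultimately show ?thesis using w by simp
  qed
qed

lemma affine_perm_id: "affine_perm n id"
  unfolding affine_perm_alt by simp

lemma affine_perm_word_prod: "n \<ge> 2 \<Longrightarrow> affine_perm n (word_prod n ws)"
  by (induction ws rule: rev_induct) (simp_all only: word_prod_simps(1) affine_perm_id word_prod_snoc affine_perm_comp_gen)

text \<open>Each letter raises \<open>shi3\<close> by at most 1 from the value 0 at the identity,
  which bounds the length from below.\<close>

lemma shi3_word_prod_le: "set ws \<subseteq> {0..<3} \<Longrightarrow> shi3 (word_prod 3 ws) \<le> int (length ws)"
proof (induction ws rule: rev_induct)
  case Nil
  then show ?case by (simp add: shi3_def)
next
  case (snoc i ws)
  have "shi3 (word_prod 3 ws \<circ> gen 3 i) \<le> shi3 (word_prod 3 ws) + 1"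
    using shi3_comp_gen[OF affine_perm_word_prod[of 3 ws], of i] snoc.prems by simp
  also have "\<dots> \<le> int (length (ws @ [i]))" using snoc by simp
  finally show ?case unfolding word_prod_snoc .
qed

text \<open>Undoing a descent lowers \<open>shi3\<close> by exactly 1, so removing descents one by
  one spells a word short enough for the upper bound on the length.\<close>

lemma shi3_word:
  assumes "affine_perm 3 w"
  shows "\<exists>ws. set ws \<subseteq> {0..<3} \<and> w = word_prod 3 ws \<and> int (length ws) \<le> shi3 w"
  using assms
proof (induction "nat (shi3 w)" arbitrary: w rule: less_induct)
  case less
  have nn: "shi3 v \<ge> 0" for v unfolding shi3_def by simp
  show ?case
  proof (cases "\<exists>i<3. w (int i) > w (int i + 1)")
    case True
    then obtain i where i: "i < 3" "w (int i) > w (int i + 1)" by blast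
    have s: "shi3 (w \<circ> gen 3 i) = shi3 w - 1" using shi3_comp_gen[OF less.prems i(1)] i(2) by simp
    then have "nat (shi3 (w \<circ> gen 3 i)) < nat (shi3 w)" using nn[of "w \<circ> gen 3 i"] by simp
    then obtain ws where ws: "set ws \<subseteq> {0..<3}" "w \<circ> gen 3 i = word_prod 3 ws"
        "int (length ws) \<le> shi3 (w \<circ> gen 3 i)"
      using less.hyps[OF _ affine_perm_comp_gen[OF _ less.prems, of i]] by auto
    have "w = (w \<circ> gen 3 i) \<circ> gen 3 i" using gen_invol[of 3] by (simp add: fun_eq_iff)
    also have "\<dots> = word_prod 3 (ws @ [i])" unfolding ws(2) word_prod_snoc ..
    finally show ?thesis using ws(1,3) s i(1) by (intro exI[of _ "ws @ [i]"]) auto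
  next
    case False
    then have "w = id" using affine_perm_no_descent[OF _ less.prems] by force
    then show ?thesis using nn by (intro exI[of _ "[]"]) simp
  qed
qed

lemma aff_length_3:
  assumes "affine_perm 3 w"
  shows "int (aff_length 3 w) = shi3 w"
proof (rule antisym)
  obtain ws where "set ws \<subseteq> {0..<3}" "w = word_prod 3 ws" "int (length ws) \<le> shi3 w"
    using shi3_word[OF assms] by blast
  then show "int (aff_length 3 w) \<le> shi3 w" using aff_length_le[of ws 3] by simp
next
  obtain ws where "length ws = aff_length 3 w" "set ws \<subseteq> {0..<3}" "w = word_prod 3 ws"
    using aff_length_word[OF _ assms] by auto
  then show "shi3 w \<le> int (aff_length 3 w)" using shi3_word_prod_le by metis
qed

section \<open>Avoiders of size 3\<close>

lemma ex_int_between: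
  fixes L U :: "int set"
  assumes "finite L" "finite U" "\<And>l u. l \<in> L \<Longrightarrow> u \<in> U \<Longrightarrow> l \<le> u"
  shows "\<exists>z. (\<forall>l\<in>L. l \<le> z) \<and> (\<forall>u\<in>U. z \<le> u)"
proof (cases "L = {}")
  case True
  then show ?thesis using assms(2) by (cases "U = {}") (auto intro!: exI[of _ "Min U"])
next
  case False
  \<comment> \<open>The extreme bound is itself an integer; with coefficients 1 and -1 no rounding
    occurs, which is why elimination is exact over the integers.\<close>
  then show ?thesis using assms by (intro exI[of _ "Max L"]) auto
qed

text \<open>Fourier-Motzkin elimination. For difference constraints it is exact over the integers.\<close>

lemma difference_system_solvable:
  fixes S :: "(nat \<times> nat \<times> ('t \<Rightarrow> int)) set"
  assumes "finite S" "\<And>i j f. (i, j, f) \<in> S \<Longrightarrow> i < k \<and> j < k \<and> f \<in> F"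
    and add: "\<And>f g. f \<in> F \<Longrightarrow> g \<in> F \<Longrightarrow> (\<lambda>\<theta>. f \<theta> + g \<theta>) \<in> F"
  shows "\<exists>H. finite H \<and> H \<subseteq> F \<and>
    (\<forall>\<theta>. (\<exists>m::nat \<Rightarrow> int. \<forall>(i, j, f)\<in>S. m i - m j \<le> f \<theta>) \<longleftrightarrow> (\<forall>f\<in>H. 0 \<le> f \<theta>))"
  using assms(1,2)
proof (induction k arbitrary: S)
  case 0
  then have "S = {}" by auto
  then show ?case by (intro exI[of _ "{}"]) simp
next
  case (Suc k)
  \<comment> \<open>The constraints are sorted by their use of the eliminated unknown
    \<open>m k\<close>: \<open>S0\<close> omits it, \<open>SL\<close> bounds it below by
    \<open>m i - f\<close>, \<open>SU\<close> bounds it above by \<open>m j + g\<close>, and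
    \<open>SD\<close> says only that \<open>f\<close> is nonnegative.\<close>
  define S0 where "S0 = {(i, j, f). (i, j, f) \<in> S \<and> i < k \<and> j < k}"
  define SL where "SL = {(i, f). (i, k, f) \<in> S \<and> i < k}"
  define SU where "SU = {(j, f). (k, j, f) \<in> S \<and> j < k}"
  define SD where "SD = {f. (k, k, f) \<in> S}"
  \<comment> \<open>Every lower bound must lie below every upper bound. The right sides are added,
    so they stay in \<open>F\<close>.\<close>
  define S' where "S' = S0 \<union> (\<lambda>((i, f), (j, g)). (i, j, \<lambda>\<theta>. f \<theta> + g \<theta>)) ` (SL \<times> SU)"
  have "finite S0" unfolding S0_def by (rule finite_subset[OF _ Suc.prems(1)]) auto
  moreover have "SL \<subseteq> (\<lambda>(i, j, f). (i, f)) ` S" unfolding SL_def by force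
  then have finL: "finite SL" using Suc.prems(1) finite_surj by blast
  moreover have "SU \<subseteq> (\<lambda>(i, j, f). (j, f)) ` S" unfolding SU_def by force
  then have finU: "finite SU" using Suc.prems(1) finite_surj by blast
  ultimately have "finite S'" unfolding S'_def by simp
  moreover have "i < k \<and> j < k \<and> f \<in> F" if "(i, j, f) \<in> S'" for i j f
    using that Suc.prems(2) add unfolding S'_def S0_def SL_def SU_def by fast
  ultimately obtain H where H: "finite H" "H \<subseteq> F"
    "\<And>\<theta>. (\<exists>m::nat \<Rightarrow> int. \<forall>(i, j, f)\<in>S'. m i - m j \<le> f \<theta>) \<longleftrightarrow> (\<forall>f\<in>H. 0 \<le> f \<theta>)"
    using Suc.IH[of S'] by blast
  have "SD \<subseteq> (\<lambda>(i, j, f). f) ` S" unfolding SD_def by force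
  then have finD: "finite SD" using Suc.prems(1) finite_surj by blast
  have "(\<exists>m::nat \<Rightarrow> int. \<forall>(i, j, f)\<in>S. m i - m j \<le> f \<theta>) \<longleftrightarrow> (\<forall>f\<in>H \<union> SD. 0 \<le> f \<theta>)" for \<theta>
  proof
    assume "\<exists>m::nat \<Rightarrow> int. \<forall>(i, j, f)\<in>S. m i - m j \<le> f \<theta>"
    then obtain m :: "nat \<Rightarrow> int" where m: "\<And>i j f. (i, j, f) \<in> S \<Longrightarrow> m i - m j \<le> f \<theta>" by blast
    have "m i - m j \<le> f \<theta>" if ijf: "(i, j, f) \<in> S'" for i j f
    proof (cases "(i, j, f) \<in> S0")
      case True
      then show ?thesis using m unfolding S0_def by blast
    next
      case False
      then obtain f' g where "(i, f') \<in> SL" "(j, g) \<in> SU" "f = (\<lambda>\<theta>. f' \<theta> + g \<theta>)"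
        using ijf unfolding S'_def by auto
      then show ?thesis using m[of i k f'] m[of k j g] unfolding SL_def SU_def by simp
    qed
    then have "\<forall>f\<in>H. 0 \<le> f \<theta>" using H(3)[of \<theta>] by blast
    moreover have "\<forall>f\<in>SD. 0 \<le> f \<theta>" using m[of k k] unfolding SD_def by simp
    ultimately show "\<forall>f\<in>H \<union> SD. 0 \<le> f \<theta>" by blast
  next
    assume *: "\<forall>f\<in>H \<union> SD. 0 \<le> f \<theta>"
    then obtain m :: "nat \<Rightarrow> int" where "\<forall>(i, j, f)\<in>S'. m i - m j \<le> f \<theta>"
      using H(3)[of \<theta>] by blast
    then have m: "\<And>i j f. (i, j, f) \<in> S' \<Longrightarrow> m i - m j \<le> f \<theta>" by blast
    have "\<exists>z. (\<forall>l\<in>(\<lambda>(i, f). m i - f \<theta>) ` SL. l \<le> z) \<and> (\<forall>u\<in>(\<lambda>(j, g). m j + g \<theta>) ` SU. z \<le> u)"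
    proof (rule ex_int_between)
      fix l u assume "l \<in> (\<lambda>(i, f). m i - f \<theta>) ` SL" "u \<in> (\<lambda>(j, g). m j + g \<theta>) ` SU"
      then obtain i f j g where ij: "(i, f) \<in> SL" "l = m i - f \<theta>" "(j, g) \<in> SU" "u = m j + g \<theta>" by auto
      then have "(i, j, \<lambda>\<theta>. f \<theta> + g \<theta>) \<in> S'" unfolding S'_def by force
      then show "l \<le> u" using m ij by fastforce
    qed (use finL finU in simp_all)
    then obtain z where z: "\<And>i f. (i, f) \<in> SL \<Longrightarrow> m i - f \<theta> \<le> z"
      "\<And>j g. (j, g) \<in> SU \<Longrightarrow> z \<le> m j + g \<theta>" by fast
    have "(m(k := z)) i - (m(k := z)) j \<le> f \<theta>" if ijf: "(i, j, f) \<in> S" for i j f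
    proof -
      have "i < Suc k" "j < Suc k" using Suc.prems(2)[OF ijf] by auto
      then consider "i < k" "j < k" | "i < k" "j = k" | "i = k" "j < k" | "i = k" "j = k" by linarith
      then show ?thesis
      proof cases
        case 1
        then show ?thesis using m[of i j f] ijf unfolding S'_def S0_def by simp
      next
        case 2
        then show ?thesis using z(1)[of i f] ijf unfolding SL_def by simp
      next
        case 3
        then show ?thesis using z(2)[of j f] ijf unfolding SU_def by simp
      next
        case 4
        then show ?thesis using * ijf unfolding SD_def by simp
      qed
    qed
    then show "\<exists>m::nat \<Rightarrow> int. \<forall>(i, j, f)\<in>S. m i - m j \<le> f \<theta>" by blast
  qed
  moreover have "SD \<subseteq> F" using Suc.prems(2) unfolding SD_def by blast
  ultimately show ?case using H(1,2) finD by (intro exI[of _ "H \<union> SD"]) simp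
qed

section \<open>Containment in size 3 as a union of polyhedra\<close>

fun pick :: "int \<times> int \<times> int \<Rightarrow> int \<Rightarrow> int" where
  "pick (a, b, c) r = (if r = 0 then a else if r = 1 then b else c)"

fun coords :: "int \<times> int \<Rightarrow> int \<times> int \<times> int" where
  "coords (x, y) = (x, y, - x - y)"

text \<open>The affine permutation with window \<open>w (r + 1) = s\<^sub>r + 3 e\<^sub>r\<close> for \<open>r = 0, 1, 2\<close>,
  where \<open>e = (x, y, - x - y)\<close>.\<close>

definition win3 :: "int \<times> int \<times> int \<Rightarrow> int \<times> int \<Rightarrow> int \<Rightarrow> int" where
  "win3 s \<theta> j = pick s ((j - 1) mod 3) + 3 * (pick (coords \<theta>) ((j - 1) mod 3) + (j - 1) div 3)"

fun aff :: "int \<times> int \<times> int \<Rightarrow> int \<times> int \<Rightarrow> int" where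
  "aff (a, b, c) (x, y) = a * x + b * y + c"

lemma win3_apply:
  assumes "r \<in> {0, 1, 2}"
  shows "win3 s \<theta> (1 + r + 3 * m) = pick s r + 3 * (pick (coords \<theta>) r + m)"
proof -
  have "(1 + r + 3 * m - 1) mod 3 = r" "(1 + r + 3 * m - 1) div 3 = m" using assms by auto
  then show ?thesis unfolding win3_def by simp
qed

text \<open>Because \<open>div\<close> rounds down, comparing two integers with given residue parts
  is exactly a difference constraint on their multiples of 3.\<close>

lemma less_div_3_iff: "c + 3 * m < c' + 3 * m' \<longleftrightarrow> m - m' \<le> (c' - c - 1) div (3::int)"
  by presburger

lemma containsI:
  assumes "distinct p" "\<And>a b. a < b \<Longrightarrow> b < length p \<Longrightarrow> idx a < idx b"
    and *: "\<And>a b. a < length p \<Longrightarrow> b < length p \<Longrightarrow> p ! a < p ! b \<Longrightarrow> w (idx a) < w (idx b)"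
  shows "contains w p"
  unfolding contains_def
proof (intro exI[of _ idx] conjI allI impI iffI)
  fix a b assume ab: "a < length p \<and> b < length p" "w (idx a) < w (idx b)"
  show "p ! a < p ! b"
  proof (rule ccontr)
    assume "\<not> p ! a < p ! b"
    then have "p ! b < p ! a \<or> a = b" using ab(1) assms(1) nth_eq_iff_index_eq by fastforce
    then show False using *[of b a] ab by auto
  qed
qed (use assms in auto)

lemma pick_coords_linear: "\<exists>a b. \<forall>x y. pick (coords (x, y)) r = a * x + b * y"
proof -
  consider "r = 0" | "r = 1" | "r \<noteq> 0" "r \<noteq> 1" by blast
  then show ?thesis
  proof cases
    case 1 then show ?thesis by (intro exI[of _ 1] exI[of _ 0]) simp
  next
    case 2 then show ?thesis by (intro exI[of _ 0] exI[of _ 1]) simp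
  next
    case 3 then show ?thesis by (intro exI[of _ "- 1"]) simp
  qed
qed

lemma pick_coords_diff_aff: "(\<lambda>\<theta>. pick (coords \<theta>) r - pick (coords \<theta>) r' + d) \<in> range aff"
proof -
  obtain a b where 1: "\<And>x y. pick (coords (x, y)) r = a * x + b * y" using pick_coords_linear by blast
  obtain a' b' where 2: "\<And>x y. pick (coords (x, y)) r' = a' * x + b' * y" using pick_coords_linear by blast
  have "(\<lambda>\<theta>. pick (coords \<theta>) r - pick (coords \<theta>) r' + d) = aff (a - a', b - b', d)"
  proof
    fix \<theta> :: "int \<times> int"
    show "pick (coords \<theta>) r - pick (coords \<theta>) r' + d = aff (a - a', b - b', d) \<theta>"
    proof (cases \<theta>)
      case (Pair x y)
      then show ?thesis using 1[of x y] 2[of x y] by (simp add: algebra_simps del: coords.simps)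
    qed
  qed
  then show ?thesis by simp
qed

text \<open>The list \<open>cs\<close> assigns to each entry of \<open>p\<close> the residue class
  of its position, that is, one of the three lines. For fixed \<open>cs\<close> the unknowns are the
  block numbers \<open>m\<close>, and eliminating them leaves finitely many affine inequalities in
  \<theta>. There are finitely many choices of \<open>cs\<close>.\<close>

lemma contains_win3_polyhedra:
  assumes "distinct p"
  shows "\<exists>(C :: int list set) \<H>. finite C \<and> (\<forall>cs\<in>C. finite (\<H> cs)) \<and>
    (\<forall>\<theta>. contains (win3 s \<theta>) p \<longleftrightarrow> (\<exists>cs\<in>C. \<forall>h\<in>\<H> cs. 0 \<le> aff h \<theta>))"
proof -
  define k where "k = length p"
  define C where "C = {cs. set cs \<subseteq> {0, 1, 2::int} \<and> length cs = k}"
  \<comment> \<open>\<open>S1\<close> makes the positions increase and has constant right sides;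
    \<open>S2\<close> gives the values the order of \<open>p\<close> and has right sides affine in
    \<theta>.\<close>
  define S1 where "S1 cs = (\<lambda>(a, b). (a, b, \<lambda>\<theta>::int \<times> int. (cs ! b - cs ! a - 1) div 3))
      ` {(a, b). a < b \<and> b < k}" for cs :: "int list"
  define S2 where "S2 cs = (\<lambda>(a, b). (a, b, \<lambda>\<theta>. pick (coords \<theta>) (cs ! b) - pick (coords \<theta>) (cs ! a)
      + (pick s (cs ! b) - pick s (cs ! a) - 1) div 3)) ` {(a, b). a < k \<and> b < k \<and> p ! a < p ! b}" for cs
  have finC: "finite C" unfolding C_def by (rule finite_lists_length_eq) simp
  have fin1: "finite (S1 cs)" for cs unfolding S1_def
    by (rule finite_imageI, rule finite_subset[of _ "{..<k} \<times> {..<k}"]) auto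
  have fin2: "finite (S2 cs)" for cs unfolding S2_def
    by (rule finite_imageI, rule finite_subset[of _ "{..<k} \<times> {..<k}"]) auto
  have const: "(\<lambda>\<theta>. d) \<in> range aff" for d
    by (rule image_eqI[of _ _ "(0, 0, d)"]) (auto simp: fun_eq_iff)
  have mem: "i < k \<and> j < k \<and> f \<in> range aff" if "(i, j, f) \<in> S1 cs \<union> S2 cs" for i j f cs
    using that pick_coords_diff_aff const unfolding S1_def S2_def by auto
  have add: "(\<lambda>\<theta>. f \<theta> + g \<theta>) \<in> range aff" if "f \<in> range aff" "g \<in> range aff" for f g
  proof -
    obtain a b c a' b' c' where "f = aff (a, b, c)" "g = aff (a', b', c')" using \<open>f \<in> range aff\<close> \<open>g \<in> range aff\<close> by auto
    then show ?thesis
      by (intro image_eqI[of _ _ "(a + a', b + b', c + c')"]) (auto simp: fun_eq_iff algebra_simps)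
  qed
  define sol where "sol cs \<theta> \<longleftrightarrow> (\<exists>m::nat \<Rightarrow> int. \<forall>(i, j, f)\<in>S1 cs \<union> S2 cs. m i - m j \<le> f \<theta>)" for cs \<theta>
  have "\<forall>cs. \<exists>H. finite H \<and> (\<forall>\<theta>. sol cs \<theta> \<longleftrightarrow> (\<forall>h\<in>H. 0 \<le> aff h \<theta>))"
  proof
    fix cs
    have "\<exists>H. finite H \<and> H \<subseteq> range aff \<and> (\<forall>\<theta>. sol cs \<theta> \<longleftrightarrow> (\<forall>f\<in>H. 0 \<le> f \<theta>))"
      unfolding sol_def
    proof (rule difference_system_solvable)
      show "finite (S1 cs \<union> S2 cs)" using fin1 fin2 by simp
    qed (fact mem, fact add)
    then obtain H where H: "finite H" "H \<subseteq> range aff" "\<forall>\<theta>. sol cs \<theta> \<longleftrightarrow> (\<forall>f\<in>H. 0 \<le> f \<theta>)" by blast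
    obtain H' where "finite H'" "H = aff ` H'" using finite_subset_image[OF H(1,2)] by blast
    then show "\<exists>H. finite H \<and> (\<forall>\<theta>. sol cs \<theta> \<longleftrightarrow> (\<forall>h\<in>H. 0 \<le> aff h \<theta>))"
      using H(3) by (intro exI[of _ H']) simp
  qed
  then have "\<exists>\<H>. \<forall>cs. finite (\<H> cs) \<and> (\<forall>\<theta>. sol cs \<theta> \<longleftrightarrow> (\<forall>h\<in>\<H> cs. 0 \<le> aff h \<theta>))"
    by (rule choice)
  then obtain \<H> where "\<forall>cs. finite (\<H> cs) \<and> (\<forall>\<theta>. sol cs \<theta> \<longleftrightarrow> (\<forall>h\<in>\<H> cs. 0 \<le> aff h \<theta>))"
    by (rule exE)
  then have \<H>: "\<And>cs. finite (\<H> cs)" "\<And>cs \<theta>. sol cs \<theta> \<longleftrightarrow> (\<forall>h\<in>\<H> cs. 0 \<le> aff h \<theta>)"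
    by (simp_all del: split_paired_All)
  have sys: "(\<forall>(i, j, f)\<in>S1 cs \<union> S2 cs. m i - m j \<le> f \<theta>) \<longleftrightarrow>
      (\<forall>a b. a < b \<and> b < k \<longrightarrow> 1 + cs ! a + 3 * m a < 1 + cs ! b + 3 * m b) \<and>
      (\<forall>a b. a < k \<and> b < k \<and> p ! a < p ! b \<longrightarrow>
        win3 s \<theta> (1 + cs ! a + 3 * m a) < win3 s \<theta> (1 + cs ! b + 3 * m b))"
    if "cs \<in> C" for cs \<theta> and m :: "nat \<Rightarrow> int"
  proof -
    have r: "cs ! a \<in> {0, 1, 2}" if "a < k" for a using that \<open>cs \<in> C\<close> nth_mem unfolding C_def by blast
    have "(\<forall>(i, j, f)\<in>S1 cs. m i - m j \<le> f \<theta>) \<longleftrightarrow>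
      (\<forall>a b. a < b \<and> b < k \<longrightarrow> 1 + cs ! a + 3 * m a < 1 + cs ! b + 3 * m b)"
      unfolding S1_def less_div_3_iff by auto
    moreover have "win3 s \<theta> (1 + cs ! a + 3 * m a) < win3 s \<theta> (1 + cs ! b + 3 * m b) \<longleftrightarrow>
      m a - m b \<le> pick (coords \<theta>) (cs ! b) - pick (coords \<theta>) (cs ! a)
        + (pick s (cs ! b) - pick s (cs ! a) - 1) div 3" if "a < k" "b < k" for a b
      unfolding win3_apply[OF r[OF that(1)]] win3_apply[OF r[OF that(2)]] less_div_3_iff by (rule iffI; linarith)
    then have "(\<forall>(i, j, f)\<in>S2 cs. m i - m j \<le> f \<theta>) \<longleftrightarrow>
      (\<forall>a b. a < k \<and> b < k \<and> p ! a < p ! b \<longrightarrow>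
        win3 s \<theta> (1 + cs ! a + 3 * m a) < win3 s \<theta> (1 + cs ! b + 3 * m b))"
      unfolding S2_def by auto
    ultimately show ?thesis by (simp only: ball_Un)
  qed
  have "contains (win3 s \<theta>) p \<longleftrightarrow> (\<exists>cs\<in>C. \<forall>h\<in>\<H> cs. 0 \<le> aff h \<theta>)" for \<theta>
  proof
    assume "contains (win3 s \<theta>) p"
    then obtain idx :: "nat \<Rightarrow> int" where idx: "\<And>a b. a < b \<Longrightarrow> b < k \<Longrightarrow> idx a < idx b"
      "\<And>a b. a < k \<Longrightarrow> b < k \<Longrightarrow> win3 s \<theta> (idx a) < win3 s \<theta> (idx b) \<longleftrightarrow> p ! a < p ! b"
      unfolding contains_def k_def by blast
    \<comment> \<open>Positions are written as \<open>1 + r + 3 * m\<close>, so residue and block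
      are taken from \<open>idx a - 1\<close>.\<close>
    define cs where "cs = map (\<lambda>a. (idx a - 1) mod 3) [0..<k]"
    define m where "m a = (idx a - 1) div 3" for a
    have "x mod 3 \<in> {0, 1, 2}" for x :: int using pos_mod_bound[of 3 x] pos_mod_sign[of 3 x] by auto
    then have cs: "cs \<in> C" unfolding C_def cs_def by auto
    have eq: "1 + cs ! a + 3 * m a = idx a" if "a < k" for a
      using that unfolding cs_def m_def by simp
    have "\<forall>(i, j, f)\<in>S1 cs \<union> S2 cs. m i - m j \<le> f \<theta>"
      unfolding sys[OF cs] using idx by (simp add: eq)
    then have "sol cs \<theta>" unfolding sol_def by (rule exI[where x = m])
    then show "\<exists>cs\<in>C. \<forall>h\<in>\<H> cs. 0 \<le> aff h \<theta>" using \<H>(2) cs by blast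
  next
    assume "\<exists>cs\<in>C. \<forall>h\<in>\<H> cs. 0 \<le> aff h \<theta>"
    then obtain cs where cs: "cs \<in> C" "sol cs \<theta>" using \<H>(2) by blast
    from cs(2) obtain m where m: "\<forall>(i, j, f)\<in>S1 cs \<union> S2 cs. m i - m j \<le> f \<theta>"
      unfolding sol_def by (rule exE)
    show "contains (win3 s \<theta>) p"
      using m unfolding sys[OF cs(1)] k_def
      by (intro containsI[OF assms, of "\<lambda>a. 1 + cs ! a + 3 * m a"]) blast+
  qed
  then show ?thesis using finC \<H>(1) by (intro exI[of _ C] exI[of _ \<H>]) blast
qed

text \<open>Containment is a Boolean combination of finitely many half-planes, so points on the same
  side of all of them agree about avoidance.\<close>

lemma avoids_win3_sign_determined:
  assumes "distinct p"
  shows "\<exists>H. finite H \<and> (1, 0, 0) \<in> H \<and> (\<forall>\<theta> \<theta>'. (\<forall>h\<in>H. (0 \<le> aff h \<theta>) = (0 \<le> aff h \<theta>')) \<longrightarrow>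
    avoids (win3 s \<theta>) p = avoids (win3 s \<theta>') p)"
proof -
  obtain C :: "int list set" and \<H> where "finite C \<and> (\<forall>cs\<in>C. finite (\<H> cs)) \<and>
    (\<forall>\<theta>. contains (win3 s \<theta>) p \<longleftrightarrow> (\<exists>cs\<in>C. \<forall>h\<in>\<H> cs. 0 \<le> aff h \<theta>))"
    using contains_win3_polyhedra[OF assms, of s] by (elim exE)
  then have C: "finite C" "\<forall>cs\<in>C. finite (\<H> cs)"
    "\<And>\<theta>. contains (win3 s \<theta>) p \<longleftrightarrow> (\<exists>cs\<in>C. \<forall>h\<in>\<H> cs. 0 \<le> aff h \<theta>)"
    by (simp_all del: split_paired_All)
  \<comment> \<open>The extra triple \<open>(1, 0, 0)\<close> is there to force a nonzero first
    coordinate on the avoider chosen in \<open>dominant_avoider\<close>.\<close>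
  show ?thesis
  proof (intro exI[of _ "insert (1, 0, 0) (\<Union>cs\<in>C. \<H> cs)"] conjI allI impI)
    fix \<theta> \<theta>' assume "\<forall>h\<in>insert (1, 0, 0) (\<Union>cs\<in>C. \<H> cs). (0 \<le> aff h \<theta>) = (0 \<le> aff h \<theta>')"
    then have "(\<forall>h\<in>\<H> cs. 0 \<le> aff h \<theta>) = (\<forall>h\<in>\<H> cs. 0 \<le> aff h \<theta>')" if "cs \<in> C" for cs
      using that by simp
    then show "avoids (win3 s \<theta>) p = avoids (win3 s \<theta>') p" unfolding avoids_def C(3) by blast
  qed (use C in auto)
qed

text \<open>Along a ray each of the finitely many affine forms eventually keeps its sign, and from
  then on membership cannot change.\<close>

lemma sign_determined_eventually_const:
  assumes "finite H" "\<And>\<theta> \<theta>'. (\<forall>h\<in>H. (0 \<le> aff h \<theta>) = (0 \<le> aff h \<theta>')) \<Longrightarrow> \<theta> \<in> A \<longleftrightarrow> \<theta>' \<in> A"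
  shows "eventually_const_on_rays A"
  unfolding eventually_const_on_rays_def
proof (intro allI)
  fix x y dx dy :: int
  define pt where "pt t = (x + t * dx, y + t * dy)" for t
  have "\<exists>s. eventually (\<lambda>t. (0 \<le> aff h (pt t)) = s) at_top" for h
  proof (cases h)
    case (fields a b c)
    obtain s where "eventually (\<lambda>t. (0 \<le> (a * x + b * y + c) + t * (a * dx + b * dy)) = s) at_top"
      using eventually_affine_sign by blast
    moreover have "aff h (pt t) = (a * x + b * y + c) + t * (a * dx + b * dy)" for t
      unfolding fields pt_def by (simp add: algebra_simps)
    ultimately show ?thesis by auto
  qed
  then have "\<exists>s. \<forall>h. eventually (\<lambda>t. (0 \<le> aff h (pt t)) = s h) at_top" by (intro choice allI)
  then obtain s where "\<forall>h. eventually (\<lambda>t. (0 \<le> aff h (pt t)) = s h) at_top" by (rule exE)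
  then have "eventually (\<lambda>t. \<forall>h\<in>H. (0 \<le> aff h (pt t)) = s h) at_top"
    by (intro eventually_ball_finite[OF assms(1)] ballI) (rule spec)
  then obtain T where T: "\<And>t h. t \<ge> T \<Longrightarrow> h \<in> H \<Longrightarrow> (0 \<le> aff h (pt t)) = s h"
    unfolding eventually_at_top_linorder by blast
  have "(pt t \<in> A) = (pt T \<in> A)" if "t \<ge> T" for t
    using T[OF that] T[of T] by (intro assms(2)) simp
  then have "eventually (\<lambda>t. (pt t \<in> A) = (pt T \<in> A)) at_top"
    unfolding eventually_at_top_linorder by blast
  then show "\<exists>b. eventually (\<lambda>t. ((x + t * dx, y + t * dy) \<in> A) = b) at_top"
    unfolding pt_def by blast
qed

section \<open>Residue part and lattice point as coordinates in size 3\<close>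

definition perms3 :: "(int \<times> int \<times> int) set" where
  "perms3 = {(a, b, c). {a, b, c} \<subseteq> {1, 2, 3} \<and> a \<noteq> b \<and> b \<noteq> c \<and> a \<noteq> c}"

lemma finite_perms3: "finite perms3"
proof (rule finite_subset)
  show "perms3 \<subseteq> {1..3} \<times> {1..3} \<times> {1..3}" unfolding perms3_def by auto
qed simp

lemma win3_window:
  "win3 (a, b, c) (x, y) 1 = a + 3 * x" "win3 (a, b, c) (x, y) 2 = b + 3 * y"
  "win3 (a, b, c) (x, y) 3 = c + 3 * (- x - y)"
  unfolding win3_def by simp_all

lemma sum_window_3: "(\<Sum>i\<in>{1..3::int}. f i) = f 1 + f 2 + (f 3 :: int)"
proof -
  have "{1..3::int} = {1, 2, 3}" by auto
  then show ?thesis by simp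
qed

lemma mod_3_cases: "(j::int) mod 3 \<in> {0, 1, 2}"
  using pos_mod_bound[of 3 j] pos_mod_sign[of 3 j] by auto

lemma mod_3_repr_unique:
  fixes a a' x x' :: int
  assumes "a \<in> {1..3}" "a' \<in> {1..3}" "a + 3 * x = a' + 3 * x'"
  shows "a = a' \<and> x = x'"
proof -
  have "1 \<le> a" "a \<le> 3" "1 \<le> a'" "a' \<le> 3" using assms by auto
  then show ?thesis using assms(3) by presburger
qed

lemma affine_perm_win3:
  assumes "s \<in> perms3"
  shows "affine_perm 3 (win3 s \<theta>)"
proof -
  obtain a b c where s: "s = (a, b, c)" by (cases s)
  obtain x y where \<theta>: "\<theta> = (x, y)" by (cases \<theta>)
  have abc: "{a, b, c} \<subseteq> {1, 2, 3}" "a \<noteq> b" "b \<noteq> c" "a \<noteq> c" using assms unfolding s perms3_def by auto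
  have rng: "pick s r \<in> {1..3}" for r using abc unfolding s by auto
  have decomp: "j = 1 + (j - 1) mod 3 + 3 * ((j - 1) div 3)" for j :: int by simp
  have "inj (win3 s \<theta>)"
  proof (rule injI)
    fix i j assume eq: "win3 s \<theta> i = win3 s \<theta> j"
    define r q where "r = (i - 1) mod 3" and "q = (j - 1) mod 3"
    have "pick s r + 3 * (pick (coords \<theta>) r + (i - 1) div 3)
        = pick s q + 3 * (pick (coords \<theta>) q + (j - 1) div 3)"
      using eq unfolding win3_def r_def q_def .
    from mod_3_repr_unique[OF rng rng this] have *: "pick s r = pick s q" "pick (coords \<theta>) r + (i - 1) div 3 = pick (coords \<theta>) q + (j - 1) div 3"
      by blast+
    have "r \<in> {0, 1, 2}" "q \<in> {0, 1, 2}" using mod_3_cases unfolding r_def q_def by blast+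
    then have "r = q" using *(1) abc(2-4) unfolding s by (auto split: if_splits)
    then have "r = q \<and> (i - 1) div 3 = (j - 1) div 3" using *(2) by simp
    then show "i = j" using decomp[of i] decomp[of j] unfolding r_def q_def by linarith
  qed
  moreover have "surj (win3 s \<theta>)"
  proof (rule surjI)
    fix v :: int
    define t where "t = (v - 1) mod 3 + 1"
    define r :: int where "r = (if t = a then 0 else if t = b then 1 else 2)"
    have "t \<in> {1, 2, 3}" using mod_3_cases[of "v - 1"] unfolding t_def by auto
    then have p: "pick s r = t" using abc unfolding s r_def by auto
    have r: "r \<in> {0, 1, 2}" unfolding r_def by auto
    have "win3 s \<theta> (1 + r + 3 * ((v - 1) div 3 - pick (coords \<theta>) r)) = t + 3 * ((v - 1) div 3)"
      unfolding win3_apply[OF r] p by simp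
    also have "\<dots> = v" unfolding t_def by simp
    finally show "win3 s \<theta> (let t = (v - 1) mod 3 + 1; r = (if t = a then 0 else if t = b then 1 else 2)
      in 1 + r + 3 * ((v - 1) div 3 - pick (coords \<theta>) r)) = v" unfolding Let_def r_def t_def .
  qed
  moreover have "win3 s \<theta> (j + int 3) = win3 s \<theta> j + int 3" for j
  proof -
    have "j + int 3 - 1 = (j - 1) + 3" by simp
    then show ?thesis unfolding win3_def by (simp only: mod_add_self2 div_add_self2) simp
  qed
  moreover have "(\<Sum>i\<in>{1..int 3}. win3 s \<theta> i - i) = 0"
  proof -
    \<comment> \<open>The residue parts contribute \<open>1 + 2 + 3\<close>, the sum of the window
      positions, and the lattice coordinates add up to 0.\<close>
    have "a + b + c = 6" using abc by auto
    then show ?thesis unfolding s \<theta> by (simp add: sum_window_3 win3_window)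
  qed
  ultimately show ?thesis unfolding affine_perm_alt bij_def by blast
qed

lemma affine_perm_3_eq_win3:
  assumes "affine_perm 3 w"
  shows "\<exists>s\<in>perms3. \<exists>\<theta>. w = win3 s \<theta>"
proof -
  have per: "\<forall>i. w (i + int 3) = w i + int 3" using assms unfolding affine_perm_alt by auto
  \<comment> \<open>Representatives are taken in 1, 2, 3 rather than 0, 1, 2: their sum is then that
    of a normalized window, which forces the coordinates to add up to 0.\<close>
  define a b c where abc: "a = (w 1 - 1) mod 3 + 1" "b = (w 2 - 1) mod 3 + 1" "c = (w 3 - 1) mod 3 + 1"
  define x y z where xyz: "x = (w 1 - 1) div 3" "y = (w 2 - 1) div 3" "z = (w 3 - 1) div 3"
  have w: "w 1 = a + 3 * x" "w 2 = b + 3 * y" "w 3 = c + 3 * z" unfolding abc xyz by simp_all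
  have rng: "a \<in> {1, 2, 3}" "b \<in> {1, 2, 3}" "c \<in> {1, 2, 3}"
    using mod_3_cases[of "w 1 - 1"] mod_3_cases[of "w 2 - 1"] mod_3_cases[of "w 3 - 1"] unfolding abc by auto
  have "\<not> 3 dvd w 1 - w 2" "\<not> 3 dvd w 2 - w 3" "\<not> 3 dvd w 1 - w 3"
    using affine_perm_3_distinct[OF assms] by simp_all
  then have ne: "a \<noteq> b" "b \<noteq> c" "a \<noteq> c" unfolding w by auto
  have "(a, b, c) \<in> perms3" using rng ne unfolding perms3_def by auto
  moreover have "a + b + c = 6" using rng ne by auto
  then have z: "z = - x - y"
    using assms unfolding affine_perm_alt by (simp add: sum_window_3 w)
  have "w j = win3 (a, b, c) (x, y) j" for j
  proof -
    define r where "r = (j - 1) mod 3"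
    define q where "q = (j - 1) div 3"
    have "j = (1 + r) + q * int 3" unfolding r_def q_def by simp
    then have "w j = w (1 + r) + 3 * q" using affine_perm_shift_mult[OF per, of "1 + r" q] by simp
    moreover have "r \<in> {0, 1, 2}" unfolding r_def by (rule mod_3_cases)
    ultimately show ?thesis unfolding win3_def r_def[symmetric] q_def[symmetric] using w z by auto
  qed
  ultimately show ?thesis by blast
qed

lemma win3_inject:
  assumes "s \<in> perms3" "s' \<in> perms3" "win3 s \<theta> = win3 s' \<theta>'"
  shows "s = s'" "\<theta> = \<theta>'"
proof -
  obtain a b c where s: "s = (a, b, c)" by (cases s)
  obtain a' b' c' where s': "s' = (a', b', c')" by (cases s')
  obtain x y where \<theta>: "\<theta> = (x, y)" by (cases \<theta>)
  obtain x' y' where \<theta>': "\<theta>' = (x', y')" by (cases \<theta>')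
  have r: "a \<in> {1..3}" "b \<in> {1..3}" "c \<in> {1..3}" "a' \<in> {1..3}" "b' \<in> {1..3}" "c' \<in> {1..3}"
    using assms(1,2) unfolding s s' perms3_def by auto
  have "a + 3 * x = a' + 3 * x'" "b + 3 * y = b' + 3 * y'" "c + 3 * (- x - y) = c' + 3 * (- x' - y')"
    using fun_cong[OF assms(3), of 1] fun_cong[OF assms(3), of 2] fun_cong[OF assms(3), of 3]
    unfolding s s' \<theta> \<theta>' win3_window by auto
  then have "a = a' \<and> x = x'" "b = b' \<and> y = y'" "c = c'"
    using mod_3_repr_unique r by blast+
  then show "s = s'" "\<theta> = \<theta>'" unfolding s s' \<theta> \<theta>' by auto
qed

text \<open>Multiples of 3 pass through \<open>div\<close> exactly, so in Shi's formula the residue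
  part contributes only these three quotients.\<close>

fun offs3 :: "int \<times> int \<times> int \<Rightarrow> int \<times> int \<times> int" where
  "offs3 (a, b, c) = ((b - a) div 3, (c - b) div 3, (c - a) div 3)"

lemma shi3_win3: "shi3 (win3 s \<theta>) = len3 (offs3 s) \<theta>"
proof -
  obtain a b c where s: "s = (a, b, c)" by (cases s)
  obtain x y where \<theta>: "\<theta> = (x, y)" by (cases \<theta>)
  have "(b + 3 * y - (a + 3 * x)) div 3 = y - x + (b - a) div 3"
    "(c + 3 * (- x - y) - (b + 3 * y)) div 3 = - x - y - y + (c - b) div 3"
    "(c + 3 * (- x - y) - (a + 3 * x)) div 3 = - x - y - x + (c - a) div 3" by presburger+
  then show ?thesis unfolding s \<theta> shi3_def win3_window offs3.simps len3.simps by (simp only:)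
qed

text \<open>The affine permutations are sorted by residue part. The coordinates are unique, so the
  classes are disjoint and each one is counted by its lattice points.\<close>

lemma coeffF_3:
  "coeffF p 3 i = (\<Sum>s\<in>perms3. card {\<theta> \<in> {\<theta>. avoids (win3 s \<theta>) p}. len3 (offs3 s) \<theta> = i})"
proof -
  let ?T = "\<lambda>s. {\<theta> \<in> {\<theta>. avoids (win3 s \<theta>) p}. len3 (offs3 s) \<theta> = i}"
  have "{w. affine_perm 3 w \<and> avoids w p \<and> int (aff_length 3 w) = i} = (\<Union>s\<in>perms3. win3 s ` ?T s)"
  proof (intro equalityI subsetI)
    fix w assume w: "w \<in> {w. affine_perm 3 w \<and> avoids w p \<and> int (aff_length 3 w) = i}"
    then obtain s \<theta> where s: "s \<in> perms3" "w = win3 s \<theta>" using affine_perm_3_eq_win3 by blast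
    then have "\<theta> \<in> ?T s" using w aff_length_3[of w] shi3_win3[of s \<theta>] by simp
    then show "w \<in> (\<Union>s\<in>perms3. win3 s ` ?T s)" using s by blast
  next
    fix w assume "w \<in> (\<Union>s\<in>perms3. win3 s ` ?T s)"
    then obtain s \<theta> where s: "s \<in> perms3" "w = win3 s \<theta>" "\<theta> \<in> ?T s" by blast
    then show "w \<in> {w. affine_perm 3 w \<and> avoids w p \<and> int (aff_length 3 w) = i}"
      using affine_perm_win3[of s \<theta>] aff_length_3[of w] shi3_win3[of s \<theta>] by simp
  qed
  then have "coeffF p 3 i = card (\<Union>s\<in>perms3. win3 s ` ?T s)" unfolding coeffF_def by simp
  also have "\<dots> = (\<Sum>s\<in>perms3. card (win3 s ` ?T s))"
  proof (rule card_UN_disjoint[OF finite_perms3])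
    have "finite (?T s)" for s by (rule finite_subset[OF _ finite_len3_level[of "offs3 s" i]]) blast
    then show "\<forall>s\<in>perms3. finite (win3 s ` ?T s)" by blast
    show "\<forall>s\<in>perms3. \<forall>s'\<in>perms3. s \<noteq> s' \<longrightarrow> win3 s ` ?T s \<inter> win3 s' ` ?T s' = {}"
      using win3_inject(1) by blast
  qed
  also have "\<dots> = (\<Sum>s\<in>perms3. card (?T s))"
    by (intro sum.cong refl card_image) (meson inj_onI win3_inject(2))
  finally show ?thesis .
qed

section \<open>A two-dimensional cone of avoiders\<close>

text \<open>If for each residue part the avoiders lay on finitely many lines, every count and hence
  their sum would be eventually periodic. So for some \<open>s\<close> an avoider escapes a finite
  family of lines, chosen so that outside it every nonconstant linear part dominates its constant
  term.\<close>

lemma dominant_avoider: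
  assumes "\<not> periodic_for p 3" "distinct p"
  shows "\<exists>s\<in>perms3. \<exists>H x y. finite H \<and> x \<noteq> 0 \<and> avoids (win3 s (x, y)) p \<and>
    (\<forall>(a, b, c)\<in>H. (a, b) \<noteq> (0, 0) \<longrightarrow> \<bar>a * x + b * y\<bar> > \<bar>c\<bar>) \<and>
    (\<forall>\<theta> \<theta>'. (\<forall>h\<in>H. (0 \<le> aff h \<theta>) = (0 \<le> aff h \<theta>')) \<longrightarrow> avoids (win3 s \<theta>) p = avoids (win3 s \<theta>') p)"
proof -
  have "\<exists>s\<in>perms3. \<not> eventually_periodic (\<lambda>i. card {\<theta> \<in> {\<theta>. avoids (win3 s \<theta>) p}. len3 (offs3 s) \<theta> = i})"
  proof (rule ccontr)
    assume "\<not> ?thesis"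
    then have "eventually_periodic (\<lambda>i. coeffF p 3 i)"
      unfolding coeffF_3 by (intro eventually_periodic_sum[OF finite_perms3]) blast
    then show False using assms(1) unfolding periodic_for_def eventually_periodic_def by blast
  qed
  then obtain s where s: "s \<in> perms3"
    and np: "\<not> eventually_periodic (\<lambda>i. card {\<theta> \<in> {\<theta>. avoids (win3 s \<theta>) p}. len3 (offs3 s) \<theta> = i})"
    by (rule bexE)
  obtain H where H: "finite H" "(1, 0, 0) \<in> H"
    and sd: "\<forall>\<theta> \<theta>'. (\<forall>h\<in>H. (0 \<le> aff h \<theta>) = (0 \<le> aff h \<theta>')) \<longrightarrow> avoids (win3 s \<theta>) p = avoids (win3 s \<theta>') p"
    using avoids_win3_sign_determined[OF assms(2), of s] by (elim exE conjE)
  \<comment> \<open>For each nonconstant form these are the lattice lines in the whole strip where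
    its linear part is at most \<open>\<bar>c\<bar>\<close> in absolute value, not only its boundary
    line.\<close>
  define Ls where "Ls = (\<Union>(a, b, c)\<in>{(a, b, c). (a, b, c) \<in> H \<and> (a, b) \<noteq> (0, 0)}. (\<lambda>d. (a, b, d)) ` {- \<bar>c\<bar>..\<bar>c\<bar>})"
  have "finite {(a, b, c). (a, b, c) \<in> H \<and> (a, b) \<noteq> (0, 0)}" by (rule finite_subset[OF _ H(1)]) auto
  then have fin: "finite Ls" unfolding Ls_def by auto
  have ne: "\<forall>(a, b, c)\<in>Ls. (a, b) \<noteq> (0, 0)" unfolding Ls_def by auto
  have ev: "eventually_const_on_rays {\<theta>. avoids (win3 s \<theta>) p}"
    by (rule sign_determined_eventually_const[OF H(1)], unfold mem_Collect_eq)
      (rule sd[THEN spec, THEN spec, THEN mp])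
  have "\<not> (\<forall>(x, y)\<in>{\<theta>. avoids (win3 s \<theta>) p}. \<exists>(a, b, c)\<in>Ls. a * x + b * y = c)"
    using np by (rule contrapos_nn) (rule eventually_periodic_card_subset_lines[OF fin ne ev])
  then obtain x y where xy: "avoids (win3 s (x, y)) p" "\<And>a b c. (a, b, c) \<in> Ls \<Longrightarrow> a * x + b * y \<noteq> c" by blast
  have dom: "\<bar>a * x + b * y\<bar> > \<bar>c\<bar>" if h: "(a, b, c) \<in> H" "(a, b) \<noteq> (0, 0)" for a b c
  proof (rule ccontr)
    assume "\<not> \<bar>a * x + b * y\<bar> > \<bar>c\<bar>"
    then have "a * x + b * y \<in> {- \<bar>c\<bar>..\<bar>c\<bar>}" by auto
    then have "(a, b, a * x + b * y) \<in> Ls" using h unfolding Ls_def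
      by (intro UN_I[of "(a, b, c)"]) auto
    then show False using xy(2) by blast
  qed
  have "x \<noteq> 0" using dom[OF H(2)] by simp
  show ?thesis
  proof (rule bexI[OF _ s], rule exI[of _ H], rule exI[of _ x], rule exI[of _ y], intro conjI)
    show "\<forall>(a, b, c)\<in>H. (a, b) \<noteq> (0, 0) \<longrightarrow> \<bar>a * x + b * y\<bar> > \<bar>c\<bar>" using dom by blast
  qed (fact H(1) \<open>x \<noteq> 0\<close> xy(1) sd)+
qed

text \<open>This evaluates a linear form with value \<open>l\<close> at \<open>(x, y)\<close> on
  \<open>N\<close> times a combination of \<open>K * (x, y)\<close> and
  \<open>K * (x, y) + (0, 1)\<close> with coefficients \<open>A\<close> and \<open>B\<close>. As
  \<open>K\<close> exceeds \<open>\<bar>b\<bar>\<close>, the perturbation \<open>B * b\<close>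
  cannot spoil the dominance over \<open>c\<close>.\<close>

lemma dominant_combination:
  fixes A B K N l b c :: int
  assumes "A \<ge> 0" "B \<ge> 0" "A + B \<ge> 1" "K > \<bar>b\<bar>" "N \<ge> 1" "l > \<bar>c\<bar>"
  shows "N * ((A + B) * K * l + B * b) > \<bar>c\<bar>"
proof -
  have "(A + B) * K \<ge> 1 * 1" using assms by (intro mult_mono) auto
  then have 1: "(A + B) * K * \<bar>c\<bar> \<ge> 1 * \<bar>c\<bar>" by (intro mult_right_mono) auto
  have "(A + B) * K * l \<ge> (A + B) * K * (\<bar>c\<bar> + 1)" using assms by (intro mult_left_mono) auto
  moreover have "B * (K + b) \<ge> B * 1" using assms by (intro mult_left_mono) auto
  moreover have "A * K \<ge> A * 1" using assms by (intro mult_left_mono) auto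
  ultimately have q: "(A + B) * K * l + B * b \<ge> \<bar>c\<bar> + 1" using 1 assms(3) by (simp add: algebra_simps)
  then have "N * ((A + B) * K * l + B * b) \<ge> 1 * ((A + B) * K * l + B * b)"
    using assms(5) by (intro mult_right_mono) auto
  then show ?thesis using q by simp
qed

text \<open>All nonzero points of the cone lie on the same side of every half-plane as one dominant
  avoider. The two spanning vectors differ by \<open>(0, 1)\<close> and are independent because
  \<open>x\<close> is nonzero; \<open>N\<close> leaves room for a later rescaling.\<close>

lemma avoiding_cone:
  assumes "\<not> periodic_for p 3" "distinct p"
  shows "\<exists>s\<in>perms3. \<exists>x y. x \<noteq> 0 \<and> (\<forall>N A B. N \<ge> 1 \<and> A \<ge> 0 \<and> B \<ge> 0 \<and> A + B \<ge> 1 \<longrightarrow>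
    avoids (win3 s (N * ((A + B) * x), N * ((A + B) * y + B))) p)"
proof -
  obtain s H x y where s: "s \<in> perms3" and H: "finite H" "x \<noteq> 0" "avoids (win3 s (x, y)) p"
    and dom: "\<forall>(a, b, c)\<in>H. (a, b) \<noteq> (0, 0) \<longrightarrow> \<bar>a * x + b * y\<bar> > \<bar>c\<bar>"
    and sd: "\<forall>\<theta> \<theta>'. (\<forall>h\<in>H. (0 \<le> aff h \<theta>) = (0 \<le> aff h \<theta>')) \<longrightarrow> avoids (win3 s \<theta>) p = avoids (win3 s \<theta>') p"
    using dominant_avoider[OF assms] by (elim bexE exE conjE)
  \<comment> \<open>\<open>K\<close> exceeds the coefficient \<open>b\<close> of every form, so a
    second spanning vector one unit higher than \<open>K * (x, y)\<close> stays on the same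
    side.\<close>
  define K where "K = 1 + (\<Sum>(a, b, c)\<in>H. \<bar>b\<bar>)"
  have K: "K > \<bar>b\<bar>" if "(a, b, c) \<in> H" for a b c
    using member_le_sum[OF that, of "\<lambda>(a, b, c). \<bar>b\<bar>"] H(1) unfolding K_def by auto
  have "K \<ge> 1" unfolding K_def by (simp add: sum_nonneg case_prod_unfold)
  have "avoids (win3 s (N * ((A + B) * (K * x)), N * ((A + B) * (K * y) + B))) p"
    if NAB: "N \<ge> 1" "A \<ge> 0" "B \<ge> 0" "A + B \<ge> 1" for N A B
  proof -
    have "(0 \<le> aff h (N * ((A + B) * (K * x)), N * ((A + B) * (K * y) + B))) = (0 \<le> aff h (x, y))"
      if "h \<in> H" for h
    proof -
      obtain a b c where h: "h = (a, b, c)" by (cases h)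
      define l where "l = a * x + b * y"
      have v: "aff h (N * ((A + B) * (K * x)), N * ((A + B) * (K * y) + B))
          = N * ((A + B) * K * l + B * b) + c" unfolding h l_def by (simp add: algebra_simps)
      have v0: "aff h (x, y) = l + c" unfolding h l_def by simp
      show ?thesis
      proof (cases "(a, b) = (0, 0)")
        case True
        then show ?thesis unfolding h by simp
      next
        case False
        then have "\<bar>l\<bar> > \<bar>c\<bar>" using dom that unfolding h l_def by auto
        then consider "l > \<bar>c\<bar>" | "- l > \<bar>c\<bar>" by linarith
        then show ?thesis
        proof cases
          case 1
          have "K > \<bar>b\<bar>" using K that unfolding h by simp
          from dominant_combination[OF NAB(2,3,4) this NAB(1) 1]
          show ?thesis unfolding v v0 using 1 by linarith
        next
          case 2
          \<comment> \<open>When the linear part is negative, the same estimate is applied to the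
            negated form.\<close>
          have "K > \<bar>- b\<bar>" using K that unfolding h by simp
          from dominant_combination[OF NAB(2,3,4) this NAB(1) 2]
          have "N * ((A + B) * K * l + B * b) < - \<bar>c\<bar>" by (simp add: algebra_simps)
          then show ?thesis unfolding v v0 using 2 by linarith
        qed
      qed
    qed
    then have "avoids (win3 s (N * ((A + B) * (K * x)), N * ((A + B) * (K * y) + B))) p
        = avoids (win3 s (x, y)) p"
      by (intro sd[THEN spec, THEN spec, THEN mp] ballI)
    then show ?thesis using H(3) by simp
  qed
  moreover have "K * x \<noteq> 0" using \<open>K \<ge> 1\<close> H(2) by simp
  ultimately show ?thesis using s by blast
qed

section \<open>Translations on three parallel lines\<close>

definition line_of :: "nat \<Rightarrow> int \<Rightarrow> int" where
  "line_of n j = (let r = (j - 1) mod int n in if r = 0 then 0 else if r = 1 then 1 else 2)"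

text \<open>All points of the graph of the translation \<open>transl n (x, y)\<close> lie on three parallel lines, with
  offsets \<open>n\<^sup>2 x\<close>, \<open>n\<^sup>2 y\<close>, \<open>n\<^sup>2 z\<close> up to a common constant, where \<open>z = - x - y\<close>. The last line carries
  \<open>n - 2\<close> residue classes; the term \<open>(3 - n) z\<close> makes the sum over a window vanish.\<close>

definition transl :: "nat \<Rightarrow> int \<times> int \<Rightarrow> int \<Rightarrow> int" where
  "transl n \<theta> j = j + int n * (int n * pick (coords \<theta>) (line_of n j) + (3 - int n) * pick (coords \<theta>) 2)"

lemma line_of_add: "line_of n (j + int n * k) = line_of n j"
proof -
  have "(j + int n * k - 1) mod int n = (j - 1) mod int n"
    using mod_mult_self2[of "j - 1" "int n" k] by (simp add: algebra_simps)
  then show ?thesis unfolding line_of_def by simp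
qed

text \<open>A translation moves each position by a multiple of \<open>n\<close> and so keeps it on
  its line; hence the shifts add.\<close>

lemma transl_add: "transl n (x + x', y + y') = transl n (x, y) \<circ> transl n (x', y')"
proof
  fix j
  have "pick (coords (x + x', y + y')) r = pick (coords (x, y)) r + pick (coords (x', y')) r" for r by simp
  moreover have "line_of n (transl n (x', y') j) = line_of n j" unfolding transl_def by (rule line_of_add)
  ultimately show "transl n (x + x', y + y') j = (transl n (x, y) \<circ> transl n (x', y')) j"
    unfolding comp_def transl_def[of n "(x + x', y + y')"] transl_def[of n "(x, y)"]
    by (simp add: transl_def algebra_simps del: coords.simps pick.simps)
qed

lemma transl_zero: "transl n (0, 0) = id"
  unfolding transl_def by (auto simp: fun_eq_iff)

lemma affine_perm_transl:
  assumes "n \<ge> 3"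
  shows "affine_perm n (transl n \<theta>)"
proof -
  obtain x y where \<theta>: "\<theta> = (x, y)" by (cases \<theta>)
  define e where "e = pick (coords \<theta>)"
  have inv: "transl n (x, y) \<circ> transl n (- x, - y) = id" "transl n (- x, - y) \<circ> transl n (x, y) = id"
    using transl_add[of n x "- x" y "- y"] transl_add[of n "- x" x "- y" y] by (simp_all add: transl_zero)
  have "bij (transl n \<theta>)" unfolding \<theta> using inv(2,1) by (rule o_bij)
  moreover have "transl n \<theta> (j + int n) = transl n \<theta> j + int n" for j
    using line_of_add[of n j 1] unfolding transl_def by simp
  moreover have "(\<Sum>j\<in>{1..int n}. transl n \<theta> j - j) = 0"
  proof -
    have l: "line_of n j = (if j = 1 then 0 else if j = 2 then 1 else 2)" if "j \<in> {1..int n}" for j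
    proof -
      have "(j - 1) mod int n = j - 1" using that by simp
      then show ?thesis unfolding line_of_def by auto
    qed
    let ?c = "(3 - int n) * e 2"
    have split: "{1..int n} = insert 1 (insert 2 {3..int n})" using assms by auto
    have "(\<Sum>j\<in>{1..int n}. transl n \<theta> j - j) = (\<Sum>j\<in>{1..int n}. int n * (int n * e (line_of n j) + ?c))"
      unfolding transl_def e_def by simp
    also have "\<dots> = (\<Sum>j\<in>{1..int n}. int n * (int n * (if j = 1 then e 0 else if j = 2 then e 1 else e 2) + ?c))"
      by (rule sum.cong) (auto simp: l)
    also have "\<dots> = int n * (int n * e 0 + ?c) + int n * (int n * e 1 + ?c)
        + (\<Sum>j\<in>{3..int n}. int n * (int n * e 2 + ?c))"
      unfolding split by simp
    also have "(\<Sum>j\<in>{3..int n}. int n * (int n * e 2 + ?c)) = (int n - 2) * (int n * (int n * e 2 + ?c))"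
      using assms by simp
    \<comment> \<open>The correction \<open>(3 - int n) * e 2\<close> occurs \<open>n\<close> times
      and reduces the \<open>n - 2\<close> copies of \<open>int n * e 2\<close> to a single one;
      then \<open>e 0 + e 1 + e 2 = 0\<close> applies.\<close>
    also have "int n * (int n * e 0 + ?c) + int n * (int n * e 1 + ?c) + (int n - 2) * (int n * (int n * e 2 + ?c)) = 0"
      unfolding e_def \<theta> by (simp add: algebra_simps)
    finally show ?thesis .
  qed
  ultimately show ?thesis unfolding affine_perm_alt by blast
qed

text \<open>Additivity reduces this to the kernel. Positions 1, 2, 3 represent the three lines;
  position 3 gives \<open>3 * z = 0\<close>, and the other two then give
  \<open>u = v = 0\<close>.\<close>

lemma transl_inject:
  assumes "n \<ge> 3" "transl n (x, y) = transl n (x', y')"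
  shows "(x, y) = (x', y')"
proof -
  define u v where "u = x - x'" and "v = y - y'"
  have "transl n (u, v) \<circ> transl n (x', y') = transl n (x, y)"
    using transl_add[of n u x' v y'] unfolding u_def v_def by simp
  then have eq: "transl n (u, v) \<circ> transl n (x', y') = id \<circ> transl n (x', y')" using assms(2) by simp
  have "surj (transl n (x', y'))" using affine_perm_transl[OF assms(1)] unfolding affine_perm_alt bij_def by blast
  then have id: "transl n (u, v) j = j" for j using eq by (metis comp_apply id_apply surjD)
  have "line_of n 1 = 0" "line_of n 2 = 1" "line_of n 3 = 2" using assms(1) unfolding line_of_def by auto
  moreover define z where "z = - u - v"
  ultimately have *: "int n * u + (3 - int n) * z = 0" "int n * v + (3 - int n) * z = 0"
      "int n * z + (3 - int n) * z = 0"
    using id[of 1] id[of 2] id[of 3] assms(1) unfolding transl_def by simp_all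
  have "z = 0" using *(3) by (simp add: algebra_simps)
  then have "u = 0" "v = 0" using *(1,2) assms(1) by simp_all
  then show ?thesis unfolding u_def v_def by simp
qed

text \<open>A position \<open>j\<close> on line \<open>c\<close> is sent to
  \<open>1 + c + 3 * j\<close>, and its value is tripled up to a common constant and an entry of
  \<open>s\<close>. Line indices, and likewise entries of \<open>s\<close>, differ by at most 2, so
  strict inequalities between positions and between values survive, for any
  \<open>s\<close>.\<close>

lemma contains_transl_imp_contains_win3:
  assumes "distinct p" "s \<in> perms3" "contains (transl n (x, y)) p"
  shows "contains (win3 s ((int n)\<^sup>2 * x, (int n)\<^sup>2 * y)) p"
proof -
  obtain idx :: "nat \<Rightarrow> int" where idx: "\<And>a b. a < b \<Longrightarrow> b < length p \<Longrightarrow> idx a < idx b"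
    "\<And>a b. a < length p \<Longrightarrow> b < length p \<Longrightarrow> transl n (x, y) (idx a) < transl n (x, y) (idx b) \<longleftrightarrow> p ! a < p ! b"
    using assms(3) unfolding contains_def by blast
  define c where "c a = line_of n (idx a)" for a
  have c: "c a \<in> {0, 1, 2}" for a unfolding c_def line_of_def Let_def by auto
  have rng: "1 \<le> pick s r \<and> pick s r \<le> 3" for r
  proof -
    obtain a1 a2 a3 where "s = (a1, a2, a3)" by (cases s)
    then show ?thesis using assms(2) unfolding perms3_def by auto
  qed
  \<comment> \<open>\<open>C\<close> is the part of the shift common to all three lines; relative to
    it the lines have offsets \<open>(int n)\<^sup>2\<close> times the coordinates.\<close>
  define C where "C = int n * (3 - int n) * (- x - y)"
  have pc: "pick (coords ((int n)\<^sup>2 * x, (int n)\<^sup>2 * y)) r = (int n)\<^sup>2 * pick (coords (x, y)) r" for r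
    by (simp add: algebra_simps)
  have val: "win3 s ((int n)\<^sup>2 * x, (int n)\<^sup>2 * y) (1 + c a + 3 * idx a)
      = pick s (c a) + 3 * (transl n (x, y) (idx a) - C)" for a
  proof -
    have "transl n (x, y) (idx a) - C = (int n)\<^sup>2 * pick (coords (x, y)) (c a) + idx a"
      unfolding transl_def C_def c_def by (simp add: algebra_simps power2_eq_square)
    then show ?thesis unfolding win3_apply[OF c] pc by simp
  qed
  have mono: "q + 3 * (v - C) < q' + 3 * (v' - C)" if "v < v'" "q \<le> 3" "1 \<le> q'" for q q' v v' :: int
    using that by (simp add: algebra_simps)
  show ?thesis
  proof (rule containsI[OF assms(1), of "\<lambda>a. 1 + c a + 3 * idx a"])
    fix a b assume "a < b" "b < length p"
    then have "idx a < idx b" by (rule idx(1))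
    then show "1 + c a + 3 * idx a < 1 + c b + 3 * idx b" using c[of a] c[of b] by auto
  next
    fix a b assume "a < length p" "b < length p" "p ! a < p ! b"
    then have "transl n (x, y) (idx a) < transl n (x, y) (idx b)" using idx(2) by blast
    then show "win3 s ((int n)\<^sup>2 * x, (int n)\<^sup>2 * y) (1 + c a + 3 * idx a)
        < win3 s ((int n)\<^sup>2 * x, (int n)\<^sup>2 * y) (1 + c b + 3 * idx b)"
      unfolding val using rng[of "c b"] rng[of "c a"] by (intro mono) simp_all
  qed
qed

section \<open>Counting short translations in the cone\<close>

lemma transl_power_word:
  assumes "transl n (x, y) = word_prod n ws"
  shows "transl n (int A * x, int A * y) = word_prod n (concat (replicate A ws))"
proof (induction A)
  case 0
  then show ?case by (simp add: transl_zero)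
next
  case (Suc A)
  have "transl n (int (Suc A) * x, int (Suc A) * y) = transl n (x + int A * x, y + int A * y)"
    by (simp add: algebra_simps)
  also have "\<dots> = word_prod n ws \<circ> word_prod n (concat (replicate A ws))"
    unfolding transl_add assms Suc ..
  also have "\<dots> = word_prod n (concat (replicate (Suc A) ws))"
    using word_prod_append[of n ws "concat (replicate A ws)"] by simp
  finally show ?case .
qed

text \<open>Words for the two spanning translations are repeated and concatenated. A linear upper
  bound is enough, so no length formula for general \<open>n\<close> enters.\<close>

lemma aff_length_transl_cone:
  assumes "n \<ge> 3"
  shows "\<exists>D. \<forall>A B L. A \<le> L \<longrightarrow> B \<le> L \<longrightarrow>
    aff_length n (transl n (int A * x + int B * x', int A * y + int B * y')) \<le> D * L"
proof -
  have n: "n \<ge> 2" using assms by simp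
  obtain us where us: "set us \<subseteq> {0..<n}" "transl n (x, y) = word_prod n us"
    using affine_perm_word[OF n affine_perm_transl[OF assms]] by blast
  obtain vs where vs: "set vs \<subseteq> {0..<n}" "transl n (x', y') = word_prod n vs"
    using affine_perm_word[OF n affine_perm_transl[OF assms]] by blast
  have "aff_length n (transl n (int A * x + int B * x', int A * y + int B * y')) \<le> (length us + length vs) * L"
    if "A \<le> L" "B \<le> L" for A B L
  proof -
    let ?w = "concat (replicate A us) @ concat (replicate B vs)"
    have "transl n (int A * x + int B * x', int A * y + int B * y') = word_prod n ?w"
      unfolding transl_add word_prod_append transl_power_word[OF us(2)] transl_power_word[OF vs(2)] ..
    moreover have "set ?w \<subseteq> {0..<n}" using us(1) vs(1) by (auto simp: set_replicate_conv_if split: if_splits)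
    ultimately have "aff_length n (transl n (int A * x + int B * x', int A * y + int B * y')) \<le> length ?w"
      using aff_length_le by metis
    also have "\<dots> = A * length us + B * length vs" by (simp add: length_concat sum_list_replicate)
    also have "\<dots> \<le> L * length us + L * length vs" using that by (intro add_mono mult_right_mono) auto
    finally show ?thesis by (simp add: algebra_simps)
  qed
  then show ?thesis by blast
qed

lemma card_le_sum_coeffF:
  assumes "n \<ge> 2" and T: "\<And>w. w \<in> T \<Longrightarrow> affine_perm n w \<and> avoids w p \<and> aff_length n w \<le> M"
  shows "card T \<le> (\<Sum>i\<in>{..M}. coeffF p n (int i))"
proof -
  let ?S = "\<lambda>i. {w. affine_perm n w \<and> avoids w p \<and> int (aff_length n w) = int i}"
  have fin: "finite (?S i)" for i
    by (rule finite_subset[OF _ finite_aff_length_level[OF assms(1), of "int i"]]) blast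
  have "T \<subseteq> (\<Union>i\<in>{..M}. ?S i)" using T by auto
  then have "card T \<le> card (\<Union>i\<in>{..M}. ?S i)" using fin by (intro card_mono) auto
  also have "\<dots> \<le> (\<Sum>i\<in>{..M}. card (?S i))" by (rule card_UN_le) simp
  finally show ?thesis unfolding coeffF_def .
qed

theorem mainTheorem14:
  fixes n :: nat and p :: "nat list"
  assumes "n > 3" and "is_pattern p" and "\<not> periodic_for p 3"
  shows "\<not> periodic_for p n"
proof
  assume "periodic_for p n"
  then have "eventually_periodic (coeffF p n)" unfolding periodic_for_def eventually_periodic_def .
  then obtain B where B: "\<And>i. i \<ge> 0 \<Longrightarrow> coeffF p n i \<le> B" using eventually_periodic_bounded by blast
  have p: "distinct p" using assms(2) unfolding is_pattern_def by simp
  have n: "n \<ge> 3" "n \<ge> 2" using assms(1) by simp_all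
  obtain s x y where s: "s \<in> perms3" and x: "x \<noteq> 0"
    and cone: "\<forall>N A B. N \<ge> 1 \<and> A \<ge> 0 \<and> B \<ge> 0 \<and> A + B \<ge> 1 \<longrightarrow>
      avoids (win3 s (N * ((A + B) * x), N * ((A + B) * y + B))) p"
    using avoiding_cone[OF assms(3) p] by (elim bexE exE conjE)
  \<comment> \<open>The spanning vectors are \<open>(x, y)\<close> and \<open>(x, y + 1)\<close>,
    matching the cone with \<open>N = 1\<close>.\<close>
  define f where "f = (\<lambda>(A, B). transl n (int A * x + int B * x, int A * y + int B * (y + 1)))"
  obtain D where D: "\<And>A B L. A \<le> L \<Longrightarrow> B \<le> L \<Longrightarrow> aff_length n (f (A, B)) \<le> D * L"
    using aff_length_transl_cone[OF n(1), of x x y "y + 1"] unfolding f_def by auto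
  have av: "avoids (f (A, B)) p" if "A \<ge> 1" for A B
  proof -
    \<comment> \<open>The cone is used at scale \<open>N = n\<^sup>2\<close>, the factor by which
      the offsets of a translation exceed its parameters.\<close>
    have "avoids (win3 s ((int n)\<^sup>2 * ((int A + int B) * x), (int n)\<^sup>2 * ((int A + int B) * y + int B))) p"
      using that n(1) by (intro cone[rule_format]) auto
    moreover have "f (A, B) = transl n ((int A + int B) * x, (int A + int B) * y + int B)"
      unfolding f_def by (simp add: algebra_simps)
    ultimately show ?thesis
      using contains_transl_imp_contains_win3[OF p s] unfolding avoids_def by auto
  qed
  have inj: "inj f"
  proof (rule injI)
    fix P Q assume eq: "f P = f Q"
    obtain A B where P: "P = (A, B)" by (cases P)
    obtain A' B' where Q: "Q = (A', B')" by (cases Q)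
    have "(int A * x + int B * x, int A * y + int B * (y + 1))
        = (int A' * x + int B' * x, int A' * y + int B' * (y + 1))"
      using eq unfolding P Q f_def prod.case by (rule transl_inject[OF n(1)])
    then have 1: "(int A + int B) * x = (int A' + int B') * x"
      and 2: "(int A + int B) * y + int B = (int A' + int B') * y + int B'" by (simp_all add: algebra_simps)
    \<comment> \<open>As \<open>x\<close> is nonzero, the first coordinate determines
      \<open>A + B\<close>; the second then determines \<open>B\<close>.\<close>
    have "int A + int B = int A' + int B'" using 1 x by simp
    then show "P = Q" using 2 unfolding P Q by simp
  qed
  \<comment> \<open>A square of \<open>L * L\<close> distinct avoiders has lengths at most
    \<open>D * L\<close>, while each of these \<open>D * L + 1\<close> coefficients is at most
    \<open>B\<close>.\<close>
  have sq: "L * L \<le> (D * L + 1) * B" for L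
  proof -
    have "card (f ` ({1..L} \<times> {1..L})) \<le> (\<Sum>i\<in>{..D * L}. coeffF p n (int i))"
      using affine_perm_transl[OF n(1)] av D
      by (intro card_le_sum_coeffF[OF n(2)]) (auto simp: f_def)
    also have "\<dots> \<le> (\<Sum>i\<in>{..D * L}. B)" using B by (intro sum_mono) simp
    finally show ?thesis using card_image[OF inj_on_subset[OF inj], of "{1..L} \<times> {1..L}"] by simp
  qed
  \<comment> \<open>With \<open>L = D * B + B + 1\<close> the left side is
    \<open>D * L * B + L * B + L\<close>, which exceeds \<open>D * L * B + B\<close> because
    \<open>L\<close> is at least 1.\<close>
  have "(D * B + B + 1) * (D * B + B + 1) \<le> (D * (D * B + B + 1) + 1) * B" by (rule sq)
  then show False by (simp add: algebra_simps)
qed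

end
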